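(* Let $\alpha,r>0$ and $w\in A_{\infty}^{\mathrm{restricted}}$. Then there exists $\delta=\delta(\alpha,w)\in(0,1)$, depending only on $\alpha$ and $w$, such that for all $a\in\mathbb{C}$ and $z\in D(a,\delta)$, $$|B^w_a(z)|\gtrsim\frac{e^{\frac{\alpha}{2}|a|^2+\frac{\alpha}{2}|z|^2}}{w(D(a,r))},$$ where the implicit constant is independent of $a$ and $z$.
   Context: A weight is a non-negative locally integrable function $w$ on $\mathbb{C}$; $dA$ (and $A(\cdot)$) is Lebesgue measure on $\mathbb{C}$; $w(E):=\int_E w\,dA$; $D(z,r)$ is the disk with center $z$ and radius $r$. Squares $Q\subset\mathbb{C}$ have sides parallel to the axes, with side length $\ell(Q)$. For $1<p<\infty$ with $1/p+1/p'=1$, $w\in A_p^{\mathrm{restricted}}$ if for some (equivalently any) fixed $r>0$, $\sup_{\ell(Q)=r}\big(\frac1{A(Q)}\int_Q w\,dA\big)\big(\frac1{A(Q)}\int_Q w^{-p'/p}dA\big)^{p/p'}<\infty$; $w\in A_1^{\mathrm{restricted}}$ if for some (equivalently any) fixed $r>0$, $\sup_{\ell(Q)=r}\big(\frac1{A(Q)}\int_Q w\,dA\big)\|w^{-1}\|_{L^\infty(Q)}<\infty$ (in particular both factors are finite, so $w>0$ a.e.). Set $A_\infty^{\mathrm{restricted}}:=\bigcup_{1\le p<\infty}A_p^{\mathrm{restricted}}$. $F^2_{\alpha,w}$ is the Hilbert space of entire functions $f$ with $\|f\|^2_{F^2_{\alpha,w}}=\int_{\mathbb{C}}|f(z)|^2e^{-\alpha|z|^2}w(z)\,dA(z)<\infty$,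 with inner product $\langle f,g\rangle_{F^2_{\alpha,w}}=\int_{\mathbb{C}}f\overline{g}\,e^{-\alpha|z|^2}w\,dA$. $B^w_a$ is its reproducing kernel at $a$: $f(a)=\langle f,B^w_a\rangle_{F^2_{\alpha,w}}$ for all $f\in F^2_{\alpha,w}$. $X\gtrsim Y$ means $X\ge cY$ for a constant $c>0$. *)

theory Defs
  imports "HOL-Complex_Analysis.Complex_Analysis" "HOL-Probability.Essential_Supremum"
begin

definition weight :: "(complex \<Rightarrow> real) \<Rightarrow> bool" where
  "weight w \<longleftrightarrow> (\<forall>z. 0 \<le> w z) \<and> (\<forall>K. compact K \<longrightarrow> set_integrable lebesgue K w)"

definition weight_mass :: "(complex \<Rightarrow> real) \<Rightarrow> complex set \<Rightarrow> real" where
  "weight_mass w E = set_lebesgue_integral lebesgue E w"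

definition square :: "complex \<Rightarrow> real \<Rightarrow> complex set" where
  "square c l = cbox c (c + Complex l l)"

definition average :: "complex set \<Rightarrow> (complex \<Rightarrow> ennreal) \<Rightarrow> ennreal" where
  "average Q f = (\<integral>\<^sup>+z\<in>Q. f z \<partial>lebesgue) / emeasure lebesgue Q"

(* The power x^s of an extended non-negative number, meant for exponents s > 0 only.
   Negative powers are written as powers of the inverse, where inverse 0 = \<infinity>,
   so that a weight vanishing on a set of positive measure has infinite dual average there. *)
definition epow :: "ennreal \<Rightarrow> real \<Rightarrow> ennreal" where
  "epow x s = (if x = \<infinity> then \<infinity> else ennreal (enn2real x powr s))"

(* Dual factor of the A_p condition on Q: for p = 1 the essential supremum of 1/w on Q,
   for p > 1 the average of w^(-p'/p) raised to the power p/p', with p' = p/(p-1). *)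
definition dual_factor :: "real \<Rightarrow> (complex \<Rightarrow> real) \<Rightarrow> complex set \<Rightarrow> ennreal" where
  "dual_factor p w Q =
     (if p = 1 then esssup (restrict_space lebesgue Q) (\<lambda>z. inverse (ennreal (w z)))
      else let p' = p / (p - 1) in
        epow (average Q (\<lambda>z. epow (inverse (ennreal (w z))) (p' / p))) (p / p'))"

(* Finiteness of the dual factor is required separately because 0 * \<infinity> = 0 in ennreal:
   otherwise w = 0 would qualify. *)
definition A_restricted :: "real \<Rightarrow> (complex \<Rightarrow> real) set" where
  "A_restricted p = {w. weight w \<and>
     (\<exists>r>0. (\<forall>c. dual_factor p w (square c r) < \<infinity>) \<and>
       (SUP c. average (square c r) (\<lambda>z. ennreal (w z)) * dual_factor p w (square c r)) < \<infinity>)}"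

definition A_infty_restricted :: "(complex \<Rightarrow> real) set" where
  "A_infty_restricted = (\<Union>p\<in>{1..}. A_restricted p)"

definition fock_space :: "real \<Rightarrow> (complex \<Rightarrow> real) \<Rightarrow> (complex \<Rightarrow> complex) set" where
  "fock_space \<alpha> w = {f. f holomorphic_on UNIV \<and>
     integrable lebesgue (\<lambda>z. (cmod (f z))\<^sup>2 * exp (- \<alpha> * (cmod z)\<^sup>2) * w z)}"

definition fock_inner ::
  "real \<Rightarrow> (complex \<Rightarrow> real) \<Rightarrow> (complex \<Rightarrow> complex) \<Rightarrow> (complex \<Rightarrow> complex) \<Rightarrow> complex" where
  "fock_inner \<alpha> w f g =
     (LINT z|lebesgue. f z * cnj (g z) * of_real (exp (- \<alpha> * (cmod z)\<^sup>2) * w z))"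

definition is_fock_kernel ::
  "real \<Rightarrow> (complex \<Rightarrow> real) \<Rightarrow> complex \<Rightarrow> (complex \<Rightarrow> complex) \<Rightarrow> bool" where
  "is_fock_kernel \<alpha> w a B \<longleftrightarrow>
     B \<in> fock_space \<alpha> w \<and> (\<forall>f\<in>fock_space \<alpha> w. f a = fock_inner \<alpha> w f B)"

definition fock_kernel :: "real \<Rightarrow> (complex \<Rightarrow> real) \<Rightarrow> complex \<Rightarrow> complex \<Rightarrow> complex" where
  "fock_kernel \<alpha> w a = (THE B. is_fock_kernel \<alpha> w a B)"

end

theory Submission
  imports Defs
begin

text \<open>The weight enters only through the following consequence of the \<open>A\<^sub>p\<close> condition at scale
  \<open>r\<^sub>0\<close>: for every square \<open>Q\<close> of side \<open>r\<^sub>0\<close> and every subsquare \<open>Q'\<close> of side \<open>s\<close>,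
  \<open>w(Q) \<le> K (r\<^sub>0/s)\<^sup>N w(Q')\<close>. Hence the mass of large boxes grows at most exponentially, so the
  Gaussian average of \<open>w\<close> around \<open>a\<close> is comparable to the mass \<open>V(a)\<close> of a box centred at \<open>a\<close>,
  and \<open>|f(z)|\<^sup>2 e\<^bsup>-\<alpha>|z|\<^sup>2\<^esup> V(z)\<close> is bounded by a multiple of \<open>\<parallel>f\<parallel>\<^sup>2\<close>. The kernel is obtained from the
  element of least norm with \<open>f(a) = 1\<close> (Montel and Fatou). By extremality
  \<open>B\<^sub>a(a) = \<parallel>B\<^sub>a\<parallel>\<^sup>2\<close> is comparable to \<open>e\<^bsup>\<alpha>|a|\<^sup>2\<^esup>/V(a)\<close>: test with \<open>z \<mapsto> e\<^bsup>\<alpha> cnj(a) z\<^esup>\<close> for the lower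
  bound. Finally the entire function \<open>g(z) = B\<^sub>a(z) e\<^bsup>-\<alpha> cnj(a) z\<^esup>\<close> is \<open>O(1/V(a))\<close> on a fixed disk
  around \<open>a\<close> and \<open>|g(a)|\<close> is at least a constant over \<open>V(a)\<close>, so by Cauchy's estimate \<open>|g|\<close> stays
  bounded below on a smaller disk of radius independent of \<open>a\<close>.\<close>

section \<open>Doubling for restricted weights\<close>

definition weight_measure :: "(complex \<Rightarrow> real) \<Rightarrow> complex measure" where
  "weight_measure w = density lebesgue (\<lambda>z. ennreal (w z))"

lemma sets_weight_measure [simp]: "sets (weight_measure w) = sets lebesgue"
  by (simp add: weight_measure_def)

lemma weight_nonneg: "weight w \<Longrightarrow> 0 \<le> w z"
  by (simp add: weight_def)

text \<open>Local integrability makes the cut-offs of \<open>w\<close> to balls measurable; at each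
  point they are eventually equal to \<open>w\<close>.\<close>

lemma weight_measurable:
  assumes "weight w"
  shows "w \<in> borel_measurable lebesgue"
proof (rule borel_measurable_LIMSEQ_real)
  show "(\<lambda>z. indicator (cball 0 (real n)) z *\<^sub>R w z) \<in> borel_measurable lebesgue" for n
    using assms unfolding weight_def set_integrable_def by (auto intro!: borel_measurable_integrable)
  fix z
  have "eventually (\<lambda>n. indicator (cball 0 (real n)) z *\<^sub>R w z = w z) sequentially"
    using eventually_ge_at_top[of "nat \<lceil>norm z\<rceil>"]
    by eventually_elim (auto simp: indicator_def nat_ceiling_le_eq)
  then show "(\<lambda>n. indicator (cball 0 (real n)) z *\<^sub>R w z) \<longlonglongrightarrow> w z"
    by (rule tendsto_eventually)
qed

lemma emeasure_weight_measure:
  assumes "weight w" "E \<in> sets lebesgue"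
  shows "emeasure (weight_measure w) E = (\<integral>\<^sup>+z\<in>E. ennreal (w z) \<partial>lebesgue)"
  using assms weight_measurable[OF assms(1)]
  by (simp add: weight_measure_def emeasure_density)

lemma weight_mass_eq_measure:
  assumes "weight w" "E \<in> sets lebesgue"
  shows "weight_mass w E = measure (weight_measure w) E"
proof -
  note [measurable] = weight_measurable[OF assms(1)] assms(2)
  have "weight_mass w E = enn2real (\<integral>\<^sup>+z. ennreal (indicator E z *\<^sub>R w z) \<partial>lebesgue)"
    unfolding weight_mass_def set_lebesgue_integral_def
    by (rule integral_eq_nn_integral) (auto simp: weight_nonneg[OF assms(1)])
  also have "(\<integral>\<^sup>+z. ennreal (indicator E z *\<^sub>R w z) \<partial>lebesgue) = (\<integral>\<^sup>+z\<in>E. ennreal (w z) \<partial>lebesgue)"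
    by (intro nn_integral_cong) (auto simp: indicator_def)
  finally show ?thesis
    by (simp add: emeasure_weight_measure[OF assms] measure_def)
qed

lemma emeasure_weight_measure_compact:
  assumes "weight w" "compact E"
  shows "emeasure (weight_measure w) E < \<infinity>"
proof -
  have E: "E \<in> sets lebesgue" using assms(2) lmeasurable_compact by blast
  have "integrable lebesgue (\<lambda>z. indicator E z *\<^sub>R w z)"
    using assms unfolding weight_def set_integrable_def by blast
  then have "(\<integral>\<^sup>+z. ennreal (norm (indicator E z *\<^sub>R w z)) \<partial>lebesgue) < \<infinity>"
    by (simp add: integrable_iff_bounded)
  also have "(\<integral>\<^sup>+z. ennreal (norm (indicator E z *\<^sub>R w z)) \<partial>lebesgue) = (\<integral>\<^sup>+z\<in>E. ennreal (w z) \<partial>lebesgue)"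
    by (intro nn_integral_cong) (auto simp: indicator_def weight_nonneg[OF assms(1)])
  finally show ?thesis
    by (simp add: emeasure_weight_measure[OF assms(1) E])
qed

lemma mem_square: "z \<in> square c l \<longleftrightarrow> Re c \<le> Re z \<and> Re z \<le> Re c + l \<and> Im c \<le> Im z \<and> Im z \<le> Im c + l"
  by (auto simp: square_def in_cbox_complex_iff)

lemma compact_square: "compact (square c l)"
  by (simp add: square_def)

lemma square_lebesgue [measurable]: "square c l \<in> sets lebesgue"
  by (simp add: square_def)

lemma emeasure_square:
  assumes "0 \<le> l"
  shows "emeasure lebesgue (square c l) = ennreal (l\<^sup>2)"
proof -
  have "emeasure lebesgue (square c l) = emeasure lborel (square c l)"
    by (simp add: square_def)
  also have "\<dots> = ennreal (\<Prod>b\<in>Basis. (c + Complex l l - c) \<bullet> b)"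
    unfolding square_def
    by (rule emeasure_lborel_cbox) (use assms in \<open>auto simp: Basis_complex_def inner_complex_def\<close>)
  also have "(\<Prod>b\<in>Basis. (c + Complex l l - c) \<bullet> b) = l\<^sup>2"
    by (simp add: Basis_complex_def inner_complex_def power2_eq_square)
  finally show ?thesis .
qed

section \<open>From the \<open>A_p\<close> condition to doubling on subsquares\<close>

lemma epow_measurable [measurable]: "(\<lambda>x. epow x s) \<in> borel_measurable borel"
  unfolding epow_def by measurable

text \<open>Truncating at the level \<open>1/t\<close> takes the place of the Hoelder inequality.\<close>

lemma one_le_weight_plus_dual:
  assumes "0 < t" "0 < s" "0 \<le> x"
  shows "1 \<le> ennreal t * ennreal x + ennreal (t powr - s) * epow (inverse (ennreal x)) s"
proof (cases "t * x \<ge> 1")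
  case True
  have "1 \<le> ennreal t * ennreal x"
    using True assms by (simp add: ennreal_mult[symmetric])
  then show ?thesis by (simp add: add_increasing2)
next
  case False
  have "1 \<le> ennreal (t powr - s) * epow (inverse (ennreal x)) s"
  proof (cases "x = 0")
    case True
    then show ?thesis using assms by (simp add: epow_def ennreal_mult_top)
  next
    case x: False
    then have "inverse (ennreal x) = ennreal (inverse x)"
      using assms by (simp add: inverse_ennreal)
    then have "ennreal (t powr - s) * epow (inverse (ennreal x)) s = ennreal (t powr - s * inverse x powr s)"
      using assms x by (simp add: epow_def ennreal_mult)
    also have "t powr - s * inverse x powr s = (t * x) powr - s"
      using assms x by (simp add: powr_mult powr_minus inverse_powr)
    finally have eq: "ennreal (t powr - s) * epow (inverse (ennreal x)) s = ennreal ((t * x) powr - s)" .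
    have "(t * x) powr s \<le> 1"
      using False assms x by (intro powr_le1) auto
    moreover have "0 < (t * x) powr s"
      using assms x by simp
    ultimately have "1 \<le> (t * x) powr - s"
      by (simp add: powr_minus one_le_inverse)
    then show ?thesis using eq by simp
  qed
  then show ?thesis by (simp add: add_increasing)
qed

text \<open>In essence Hoelder's inequality for \<open>1 = w^(1/p) * w^(-1/p)\<close> on
  \<open>E\<close>, with the dual integral enlarged to the whole square. The 2 is the price of
  truncation, where half the area of \<open>E\<close> is absorbed.\<close>

lemma dual_factor_lower_bound:
  assumes w: "weight w" and p: "1 \<le> p" and l: "0 < l"
    and E: "E \<in> sets lebesgue" "E \<subseteq> square c l"
    and fin: "dual_factor p w (square c l) < \<infinity>"
  shows "(measure lebesgue E / (2 * l\<^sup>2)) powr p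
           \<le> enn2real (dual_factor p w (square c l)) * (weight_mass w E / l\<^sup>2)"
proof -
  note [measurable] = weight_measurable[OF w] E(1)
  define Q where "Q = square c l"
  define A where "A = measure lebesgue E"
  define m where "m = weight_mass w E"
  have EQ: "E \<subseteq> Q" and Qm [measurable]: "Q \<in> sets lebesgue"
    using E by (auto simp: Q_def)
  have Qe: "emeasure lebesgue Q = ennreal (l\<^sup>2)"
    unfolding Q_def by (rule emeasure_square) (use l in simp)
  have "emeasure lebesgue E \<le> ennreal (l\<^sup>2)"
    using emeasure_mono[OF EQ Qm] Qe by simp
  then have "emeasure lebesgue E \<noteq> top"
    using ennreal_less_top le_less_trans less_irrefl by metis
  then have Ae: "emeasure lebesgue E = ennreal A"
    unfolding A_def by (rule emeasure_eq_ennreal_measure)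
  have A0: "0 \<le> A" by (simp add: A_def)
  have "emeasure (weight_measure w) E \<le> emeasure (weight_measure w) Q"
    by (rule emeasure_mono) (use EQ in auto)
  also have "\<dots> < \<infinity>"
    unfolding Q_def by (rule emeasure_weight_measure_compact[OF w compact_square])
  finally have "emeasure (weight_measure w) E < \<infinity>" .
  then have me: "(\<integral>\<^sup>+z\<in>E. ennreal (w z) \<partial>lebesgue) = ennreal m"
    unfolding m_def weight_mass_eq_measure[OF w E(1)] emeasure_weight_measure[OF w E(1), symmetric]
    by (simp add: emeasure_eq_ennreal_measure)
  have m0: "0 \<le> m"
    by (simp add: m_def weight_mass_eq_measure[OF w E(1)])
  have l2: "0 < l\<^sup>2" using l by simp
  define D where "D = enn2real (dual_factor p w Q)"
  have De: "dual_factor p w Q = ennreal D"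
    using fin by (simp add: D_def Q_def less_top)
  have D0: "0 \<le> D" by (simp add: D_def)
  have "(A / (2 * l\<^sup>2)) powr p \<le> D * (m / l\<^sup>2)"
  proof (cases "p = 1")
    case True
    \<comment> \<open>For \<open>p = 1\<close> the essential supremum \<open>D\<close> gives
      \<open>1 \<le> D * w\<close> almost everywhere on \<open>Q\<close>, which is integrated over
      \<open>E\<close>.\<close>
    have "AE z in restrict_space lebesgue Q. inverse (ennreal (w z)) \<le> ennreal D"
      using esssup_AE[of "\<lambda>z. inverse (ennreal (w z))" "restrict_space lebesgue Q"] De True
      by (simp add: dual_factor_def)
    then have ae: "AE z in lebesgue. z \<in> Q \<longrightarrow> inverse (ennreal (w z)) \<le> ennreal D"
      by (subst (asm) AE_restrict_space_iff) auto
    have "ennreal A = (\<integral>\<^sup>+z. indicator E z \<partial>lebesgue)"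
      using Ae by simp
    also have "\<dots> \<le> (\<integral>\<^sup>+z. ennreal D * (ennreal (w z) * indicator E z) \<partial>lebesgue)"
    proof (rule nn_integral_mono_AE)
      show "AE z in lebesgue. indicator E z \<le> ennreal D * (ennreal (w z) * indicator E z)"
        using ae
      proof eventually_elim
        case (elim z)
        show ?case
        proof (cases "z \<in> E")
          case True
          then have *: "inverse (ennreal (w z)) \<le> ennreal D" using elim EQ by auto
          have "w z \<noteq> 0"
          proof
            assume "w z = 0"
            with * show False by (simp add: top_unique)
          qed
          then have wp: "w z > 0" using weight_nonneg[OF w, of z] by simp
          then have "ennreal (inverse (w z)) \<le> ennreal D"
            using * by (simp add: inverse_ennreal)
          then have "inverse (w z) \<le> D"
            using D0 by simp
          then have "1 \<le> D * w z"
            using wp by (simp add: field_simps)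
          then have "1 \<le> ennreal D * ennreal (w z)"
            using D0 wp by (simp add: ennreal_mult[symmetric])
          then show ?thesis using True by simp
        qed simp
      qed
    qed
    also have "\<dots> = ennreal D * ennreal m"
      by (simp add: nn_integral_cmult me)
    finally have "A \<le> D * m"
      using D0 m0 by (simp add: ennreal_mult[symmetric])
    then show ?thesis
      using True A0 l2 by (simp add: field_simps)
  next
    case False
    then have p1: "p > 1" using p by simp
    \<comment> \<open>Here \<open>p'/p = 1/(p-1)\<close> and \<open>p/p' = p-1\<close>, so
      \<open>\<phi>\<close> is the dual weight and \<open>D = J powr (p-1)\<close> for its average
      \<open>J\<close> over \<open>Q\<close>.\<close>
    define s where "s = 1 / (p - 1)"
    have s0: "0 < s" using p1 by (simp add: s_def)
    define \<phi> where "\<phi> z = epow (inverse (ennreal (w z))) s" for z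
    have \<phi>m [measurable]: "\<phi> \<in> borel_measurable lebesgue"
      unfolding \<phi>_def by measurable
    have De': "epow (average Q \<phi>) (p - 1) = ennreal D"
      using De p1 by (simp add: dual_factor_def Let_def \<phi>_def[abs_def] s_def)
    then have "average Q \<phi> \<noteq> \<infinity>"
      by (auto simp: epow_def)
    then obtain J where J: "average Q \<phi> = ennreal J" "0 \<le> J"
      by (cases "average Q \<phi>") auto
    have DJ: "D = J powr (p - 1)"
      using De' J D0 by (simp add: epow_def)
    have "(\<integral>\<^sup>+z\<in>Q. \<phi> z \<partial>lebesgue) / ennreal (l\<^sup>2) = ennreal J"
      using J Qe by (simp add: average_def)
    then have IQ: "(\<integral>\<^sup>+z\<in>Q. \<phi> z \<partial>lebesgue) = ennreal (J * l\<^sup>2)"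
      using l2 J by (cases "\<integral>\<^sup>+z\<in>Q. \<phi> z \<partial>lebesgue")
        (auto simp: divide_ennreal ennreal_top_divide field_simps)
    \<comment> \<open>Integrate the truncation bound over \<open>E\<close>, then enlarge the domain
      of the dual integral to \<open>Q\<close>; \<open>t\<close> stays free.\<close>
    have key: "A \<le> t * m + t powr - s * (J * l\<^sup>2)" if t: "0 < t" for t
    proof -
      have "ennreal A = (\<integral>\<^sup>+z\<in>E. 1 \<partial>lebesgue)"
        using Ae by simp
      also have "\<dots> \<le> (\<integral>\<^sup>+z\<in>E. (ennreal t * ennreal (w z) + ennreal (t powr - s) * \<phi> z) \<partial>lebesgue)"
        unfolding \<phi>_def
        by (intro nn_integral_mono mult_right_mono one_le_weight_plus_dual t s0 weight_nonneg[OF w]) auto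
      also have "\<dots> = (\<integral>\<^sup>+z. (ennreal t * (ennreal (w z) * indicator E z) + ennreal (t powr - s) * (\<phi> z * indicator E z)) \<partial>lebesgue)"
        by (simp add: distrib_right mult.assoc)
      also have "\<dots> = ennreal t * ennreal m + ennreal (t powr - s) * (\<integral>\<^sup>+z\<in>E. \<phi> z \<partial>lebesgue)"
        by (simp add: nn_integral_add nn_integral_cmult me)
      also have "\<dots> \<le> ennreal t * ennreal m + ennreal (t powr - s) * (\<integral>\<^sup>+z\<in>Q. \<phi> z \<partial>lebesgue)"
        by (intro add_left_mono mult_left_mono nn_integral_mono) (use EQ in \<open>auto simp: indicator_def\<close>)
      also have "\<dots> = ennreal (t * m + t powr - s * (J * l\<^sup>2))"
        using t m0 J by (simp add: IQ ennreal_mult ennreal_plus)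
      finally show ?thesis
        using t m0 J by (subst (asm) ennreal_le_iff) auto
    qed
    define x where "x = A / (2 * l\<^sup>2)"
    have x0: "0 \<le> x" using A0 by (simp add: x_def)
    have Ax: "A = 2 * x * l\<^sup>2" using l by (simp add: x_def)
    have "x powr p \<le> D * (m / l\<^sup>2)"
    proof (cases "x = 0")
      case True
      then show ?thesis using D0 m0 by simp
    next
      case False
      then have xp: "0 < x" using x0 by simp
      \<comment> \<open>If \<open>J\<close> vanished, a \<open>t\<close> so small that
        \<open>t * m < A\<close> would contradict \<open>key\<close>.\<close>
      have Jp: "0 < J"
      proof (rule ccontr)
        assume "\<not> 0 < J"
        then have "J = 0" using J by simp
        have Ap: "0 < A" using Ax xp l by simp
        have "A \<le> A / (2 * (m + 1)) * m"
          using key[of "A / (2 * (m + 1))"] \<open>J = 0\<close> Ap m0 by simp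
        also have "\<dots> < A"
          using Ap m0 by (simp add: field_simps add_pos_nonneg add_nonneg_pos)
        finally show False by simp
      qed
      \<comment> \<open>With this \<open>t\<close> the dual term equals \<open>x * l^2\<close>, half
        the area of \<open>E\<close>, and is absorbed into the left side.\<close>
      define t where "t = (J / x) powr (p - 1)"
      have t0: "0 < t" using Jp xp by (simp add: t_def)
      have "t powr - s = (J / x) powr - 1"
        using p1 by (simp add: t_def powr_powr s_def)
      also have "\<dots> = x / J"
        using Jp xp by (simp add: powr_minus_divide)
      finally have tS: "t powr - s * (J * l\<^sup>2) = x * l\<^sup>2"
        using Jp by simp
      have "2 * x * l\<^sup>2 \<le> t * m + x * l\<^sup>2"
        using key[OF t0] unfolding tS Ax .
      then have "x * l\<^sup>2 \<le> t * m" by simp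
      then have "x \<le> t * (m / l\<^sup>2)"
        using l2 by (simp add: field_simps)
      then have "x powr (p - 1) * x \<le> x powr (p - 1) * (t * (m / l\<^sup>2))"
        by (rule mult_left_mono) simp
      moreover have "x powr (p - 1) * x = x powr p"
        using xp by (simp add: powr_mult_base powr_diff)
      moreover have "x powr (p - 1) * t = D"
        using xp Jp by (simp add: t_def DJ powr_divide)
      ultimately show ?thesis
        by (simp add: mult.assoc[symmetric])
    qed
    then show ?thesis by (simp add: x_def)
  qed
  then show ?thesis by (simp add: A_def m_def D_def Q_def)
qed

text \<open>Take \<open>E\<close> to be the small square in the lower bound and multiply by the mass
  of the large one: the product of average and dual factor is at most the \<open>A_p\<close>
  constant, which leaves a power of the area ratio. The same inequality shows that the small mass is
  positive.\<close>

lemma A_infty_subsquare_doubling: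
  assumes "w \<in> A_infty_restricted"
  obtains r0 K :: real and N :: nat where "0 < r0" "0 < K" "0 < N"
    "\<And>b c s. 0 < s \<Longrightarrow> square c s \<subseteq> square b r0 \<Longrightarrow>
       0 < weight_mass w (square c s) \<and>
       weight_mass w (square b r0) \<le> K * (r0 / s) ^ N * weight_mass w (square c s)"
proof -
  obtain p where p: "1 \<le> p" and "w \<in> A_restricted p"
    using assms by (auto simp: A_infty_restricted_def)
  then obtain r0 where w: "weight w" and r0: "0 < r0"
    and fin: "\<And>c. dual_factor p w (square c r0) < \<infinity>"
    and sup: "(SUP c. average (square c r0) (\<lambda>z. ennreal (w z)) * dual_factor p w (square c r0)) < \<infinity>"
    by (auto simp: A_restricted_def)
  define k where "k = enn2real (SUP c. average (square c r0) (\<lambda>z. ennreal (w z)) * dual_factor p w (square c r0))"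
  have k0: "0 \<le> k" by (simp add: k_def)
  have bnd: "weight_mass w (square c r0) / r0\<^sup>2 * enn2real (dual_factor p w (square c r0)) \<le> k" for c
  proof -
    have "average (square c r0) (\<lambda>z. ennreal (w z)) * dual_factor p w (square c r0) \<le> ennreal k"
      using sup by (auto simp: k_def intro!: SUP_upper)
    moreover have "average (square c r0) (\<lambda>z. ennreal (w z)) = ennreal (weight_mass w (square c r0) / r0\<^sup>2)"
      using emeasure_weight_measure_compact[OF w compact_square, of c r0] r0
      unfolding average_def emeasure_square[OF less_imp_le[OF r0]] emeasure_weight_measure[OF w square_lebesgue, symmetric]
      by (simp add: weight_mass_eq_measure[OF w] emeasure_eq_ennreal_measure divide_ennreal)
    moreover have "dual_factor p w (square c r0) = ennreal (enn2real (dual_factor p w (square c r0)))"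
      using fin[of c] by (simp add: less_top)
    ultimately have "ennreal (weight_mass w (square c r0) / r0\<^sup>2) * ennreal (enn2real (dual_factor p w (square c r0))) \<le> ennreal k"
      by simp
    then show ?thesis
      by (simp add: ennreal_mult[symmetric] weight_mass_eq_measure[OF w] k0)
  qed
  \<comment> \<open>The area ratio \<open>(s/r0)^2\<close> to the power \<open>p\<close> gives the
    exponent \<open>2 * p\<close>; rounding it up is harmless since
    \<open>r0/s \<ge> 1\<close>.\<close>
  define N where "N = nat \<lceil>2 * p\<rceil>"
  \<comment> \<open>\<open>2 powr p\<close> comes from the 2 in the lower bound;
    \<open>k + 1\<close> keeps \<open>K\<close> positive even if \<open>k = 0\<close>.\<close>
  define K where "K = 2 powr p * (k + 1)"
  have K: "0 < K" using k0 by (simp add: K_def)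
  have main: "0 < weight_mass w (square c s) \<and>
       weight_mass w (square b r0) \<le> K * (r0 / s) ^ N * weight_mass w (square c s)"
    if s: "0 < s" and sub: "square c s \<subseteq> square b r0" for b c s
  proof -
    define D where "D = enn2real (dual_factor p w (square b r0))"
    define m where "m = weight_mass w (square c s)"
    define M where "M = weight_mass w (square b r0)"
    have m0: "0 \<le> m" and M0: "0 \<le> M"
      by (simp_all add: m_def M_def weight_mass_eq_measure[OF w])
    have "c \<in> square c s" "c + Complex s s \<in> square c s"
      using s by (auto simp: mem_square)
    then have "c \<in> square b r0" "c + Complex s s \<in> square b r0"
      using sub by auto
    then have sr: "s \<le> r0" by (auto simp: mem_square)
    define y where "y = (s\<^sup>2 / (2 * r0\<^sup>2)) powr p"
    have y0: "0 < y" using s r0 by (simp add: y_def)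
    have "measure lebesgue (square c s) = s\<^sup>2"
      unfolding measure_def emeasure_square[OF less_imp_le[OF s]] by simp
    then have "y \<le> D * (m / r0\<^sup>2)"
      using dual_factor_lower_bound[OF w p r0 _ sub fin]
      by (simp add: y_def D_def m_def)
    then have "0 < D * (m / r0\<^sup>2)" using y0 by linarith
    then have mp: "0 < m" using m0 r0 by (cases "m = 0") auto
    have "M * y \<le> M * (D * (m / r0\<^sup>2))"
      using \<open>y \<le> D * (m / r0\<^sup>2)\<close> M0 by (rule mult_left_mono)
    also have "\<dots> = (M / r0\<^sup>2 * D) * m" by simp
    also have "\<dots> \<le> k * m"
      using bnd[of b] m0 by (intro mult_right_mono) (auto simp: M_def D_def)
    finally have My: "M \<le> k * m / y" using y0 by (simp add: field_simps)
    have "1 / y = 2 powr p * (r0 / s) powr (2 * p)"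
      using s r0 by (simp add: y_def powr_divide powr_mult powr_powr powr_numeral[symmetric] del: powr_numeral)
    also have "\<dots> \<le> 2 powr p * (r0 / s) powr real N"
      using s sr by (intro mult_left_mono powr_mono) (auto simp: N_def real_nat_ceiling_ge)
    also have "\<dots> = 2 powr p * (r0 / s) ^ N"
      using s r0 by (simp add: powr_realpow)
    finally have "1 / y \<le> 2 powr p * (r0 / s) ^ N" .
    then have "k * m * (1 / y) \<le> (k + 1) * m * (2 powr p * (r0 / s) ^ N)"
      using k0 m0 y0 by (intro mult_mono) auto
    then have "M \<le> K * (r0 / s) ^ N * m"
      using My by (simp add: K_def mult_ac)
    with mp show ?thesis by (simp add: m_def M_def)
  qed
  have "0 < N" using p by (simp add: N_def)
  then show thesis by (rule that[OF r0 K _ main])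
qed

section \<open>Measures doubling on subsquares\<close>

text \<open>Balls of the maximum norm: inclusions and coverings become inequalities in each
  coordinate.\<close>

definition box_at :: "complex \<Rightarrow> real \<Rightarrow> complex set" where
  "box_at a l = square (a - Complex l l) (2 * l)"

lemma mem_box_at: "z \<in> box_at a l \<longleftrightarrow> \<bar>Re z - Re a\<bar> \<le> l \<and> \<bar>Im z - Im a\<bar> \<le> l"
  by (auto simp: box_at_def mem_square)

lemma cball_subset_box_at: "cball a l \<subseteq> box_at a l"
proof
  fix z assume "z \<in> cball a l"
  then have "cmod (z - a) \<le> l" by (simp add: dist_norm norm_minus_commute)
  then show "z \<in> box_at a l"
    using abs_Re_le_cmod[of "z - a"] abs_Im_le_cmod[of "z - a"] by (simp add: mem_box_at)
qed

lemma norm_le_of_mem_box_at: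
  assumes "z \<in> box_at a l"
  shows "(cmod (z - a))\<^sup>2 \<le> 2 * l\<^sup>2"
proof -
  have "\<bar>Re z - Re a\<bar>\<^sup>2 \<le> l\<^sup>2"
    by (rule power_mono) (use assms in \<open>simp_all add: mem_box_at\<close>)
  moreover have "\<bar>Im z - Im a\<bar>\<^sup>2 \<le> l\<^sup>2"
    by (rule power_mono) (use assms in \<open>simp_all add: mem_box_at\<close>)
  ultimately show ?thesis by (simp add: cmod_power2)
qed

lemma box_at_subset_ball:
  assumes "0 < l" "2 * l \<le> d"
  shows "box_at a l \<subseteq> ball a d"
proof
  fix z assume "z \<in> box_at a l"
  then have "(cmod (z - a))\<^sup>2 \<le> 2 * l\<^sup>2" by (rule norm_le_of_mem_box_at)
  also have "\<dots> < (2 * l)\<^sup>2" using assms by (simp add: power_mult_distrib)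
  finally have "cmod (z - a) < 2 * l"
    by (rule power2_less_imp_less) (use assms in simp)
  then show "z \<in> ball a d" using assms by (simp add: dist_norm norm_minus_commute)
qed

text \<open>The ambient squares have half-side \<open>2 * h\<close>, which leaves room for two boxes
  of half-side \<open>h\<close> whose centres differ by at most \<open>h\<close> in each coordinate.
  Doubling is given at this one ambient scale; larger boxes have to be reached by covering.\<close>

locale subsquare_doubling =
  fixes M :: "complex measure" and h K :: real and N :: nat
  assumes sets_M: "sets M = sets lebesgue"
    and h_pos: "0 < h" and K_pos: "0 < K" and N_pos: "0 < N"
    and finite_square: "emeasure M (square c l) < \<infinity>"
    and pos_square: "0 < s \<Longrightarrow> square c s \<subseteq> square b (4 * h) \<Longrightarrow> 0 < measure M (square c s)"
    and doubling_square: "0 < s \<Longrightarrow> square c s \<subseteq> square b (4 * h) \<Longrightarrow>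
      measure M (square b (4 * h)) \<le> K * (4 * h / s) ^ N * measure M (square c s)"
begin

definition V :: "complex \<Rightarrow> real" where
  "V a = measure M (box_at a h)"

text \<open>\<open>K * 2 ^ N\<close> bounds the mass ratio between half-sides \<open>2 * h\<close>
  and \<open>h\<close>; the 4 pays for the four translates that cover an enlarged box.\<close>

definition L :: real where
  "L = 4 * (K * 2 ^ N)"

lemma sets_box_at [measurable]: "box_at a l \<in> sets M"
  by (simp add: sets_M box_at_def)

lemma finite_box_at: "emeasure M (box_at a l) < \<infinity>"
  unfolding box_at_def by (rule finite_square)

lemma fmeasurable_box_at: "box_at a l \<in> fmeasurable M"
  using finite_box_at by (simp add: fmeasurable_def)

lemma emeasure_box_at: "emeasure M (box_at a l) = ennreal (measure M (box_at a l))"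
  using finite_box_at[of a l] by (simp add: emeasure_eq_ennreal_measure)

lemma doubling_box:
  assumes "0 < s" "box_at a s \<subseteq> box_at b (2 * h)"
  shows "measure M (box_at b (2 * h)) \<le> K * (2 * h / s) ^ N * measure M (box_at a s)"
  using doubling_square[of "2 * s" "a - Complex s s" "b - Complex (2 * h) (2 * h)"] assms
  by (simp add: box_at_def)

lemma L_pos: "0 < L"
  using K_pos by (simp add: L_def)

lemma V_pos: "0 < V a"
  unfolding V_def box_at_def
  supply [[show_types]] thm pos_square
  supply [[show_types]] thm pos_square[where b = "a - Complex (2 * h) (2 * h)"]
  using h_pos by (intro pos_square[where b = "a - Complex (2 * h) (2 * h)"]) (auto simp: mem_square)

text \<open>Both boxes lie in the box of half-side \<open>2 * h\<close> about the midpoint of the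
  centres, where doubling compares them. The 4 on the left offsets a later sum over four
  translates.\<close>

lemma V_shift:
  assumes "\<bar>Re b - Re a\<bar> \<le> h" "\<bar>Im b - Im a\<bar> \<le> h"
  shows "4 * V b \<le> L * V a"
proof -
  define m where "m = (a + b) / 2"
  have m: "Re m = (Re a + Re b) / 2" "Im m = (Im a + Im b) / 2"
    by (simp_all add: m_def)
  have sub: "box_at c h \<subseteq> box_at m (2 * h)" if "c = a \<or> c = b" for c
  proof
    fix z assume z: "z \<in> box_at c h"
    have "z \<in> box_at m (2 * h)" if "c = a"
      using z assms unfolding mem_box_at m that by argo
    moreover have "z \<in> box_at m (2 * h)" if "c = b"
      using z assms unfolding mem_box_at m that by argo
    ultimately show "z \<in> box_at m (2 * h)" using that by blast
  qed
  have "V b \<le> measure M (box_at m (2 * h))"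
    unfolding V_def by (rule measure_mono_fmeasurable[OF sub _ fmeasurable_box_at]) simp_all
  also have "\<dots> \<le> K * 2 ^ N * V a"
    using doubling_box[OF h_pos sub, of a] h_pos by (simp add: V_def)
  finally show ?thesis by (simp add: L_def)
qed

text \<open>A box of half-side \<open>l + h\<close> is covered by the four translates of the box of half-side
  \<open>l \<ge> h\<close> by \<open>(\<plusminus>h, \<plusminus>h)\<close>.\<close>

lemma box_growth: "measure M (box_at a (real (Suc n) * h)) \<le> L ^ n * V a"
proof (induction n arbitrary: a)
  case 0
  then show ?case by (simp add: V_def)
next
  case (Suc n)
  define l where "l = real (Suc n) * h"
  have hl: "h \<le> l" using h_pos by (simp add: l_def)
  define S where "S = {Complex h h, Complex h (-h), Complex (-h) h, Complex (-h) (-h)}"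
  have S: "finite S" "card S \<le> 4" and Sh: "\<And>v. v \<in> S \<Longrightarrow> \<bar>Re v\<bar> \<le> h \<and> \<bar>Im v\<bar> \<le> h"
    using h_pos by (auto simp: S_def card_insert_if)
  have sub: "box_at a (l + h) \<subseteq> (\<Union>v\<in>S. box_at (a + v) l)"
  proof
    fix z assume z: "z \<in> box_at a (l + h)"
    \<comment> \<open>The shift points into the quadrant about \<open>a\<close> that contains
      \<open>z\<close>.\<close>
    define v where "v = Complex (if Re z \<ge> Re a then h else - h) (if Im z \<ge> Im a then h else - h)"
    have "v \<in> S" by (auto simp: v_def S_def)
    moreover have "\<bar>x - (y + (if x \<ge> y then h else - h))\<bar> \<le> l" if "\<bar>x - y\<bar> \<le> l + h" for x y :: real
      using that hl h_pos by (cases "x \<ge> y") (simp_all add: abs_le_iff)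
    then have "z \<in> box_at (a + v) l"
      using z by (simp add: mem_box_at v_def)
    ultimately show "z \<in> (\<Union>v\<in>S. box_at (a + v) l)" by blast
  qed
  have "measure M (box_at a (l + h)) \<le> measure M (\<Union>v\<in>S. box_at (a + v) l)"
    by (rule measure_mono_fmeasurable[OF sub])
      (use S in \<open>auto intro!: fmeasurable.finite_Union fmeasurable_box_at\<close>)
  also have "\<dots> \<le> (\<Sum>v\<in>S. measure M (box_at (a + v) l))"
    by (rule measure_UNION_le) (use S in auto)
  also have "\<dots> \<le> (\<Sum>v\<in>S. L ^ n * (L * V a / 4))"
  \<comment> \<open>Induction at the shifted centre costs \<open>L ^ n\<close>, the return to
    \<open>a\<close> costs \<open>L / 4\<close>, and there are at most four terms.\<close>
  proof (rule sum_mono)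
    fix v assume "v \<in> S"
    then have "V (a + v) \<le> L * V a / 4"
      using V_shift[of "a + v" a] Sh[of v] by simp
    then have "L ^ n * V (a + v) \<le> L ^ n * (L * V a / 4)"
      using L_pos by (intro mult_left_mono) auto
    then show "measure M (box_at (a + v) l) \<le> L ^ n * (L * V a / 4)"
      using Suc.IH[of "a + v"] by (simp add: l_def)
  qed
  also have "\<dots> = real (card S) * (L ^ n * (L * V a / 4))" by simp
  also have "\<dots> \<le> 4 * (L ^ n * (L * V a / 4))"
    using S L_pos V_pos[of a] by (intro mult_right_mono) auto
  also have "\<dots> = L ^ Suc n * V a" by simp
  finally show ?case by (simp add: l_def algebra_simps)
qed

text \<open>The box of \<open>V a\<close> lies in the box of half-side \<open>(n + 1) * h\<close>
  about \<open>z\<close>, whose growth is known.\<close>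

lemma V_compare:
  assumes "dist a z \<le> real n * h"
  shows "V a \<le> L ^ n * V z"
proof -
  have "cmod (a - z) \<le> real n * h" using assms by (simp add: dist_norm)
  then have "\<bar>Re a - Re z\<bar> \<le> real n * h" "\<bar>Im a - Im z\<bar> \<le> real n * h"
    using abs_Re_le_cmod[of "a - z"] abs_Im_le_cmod[of "a - z"] by simp_all
  then have "u \<in> box_at z (real n * h + h)" if "u \<in> box_at a h" for u
    using that unfolding mem_box_at by argo
  then have "box_at a h \<subseteq> box_at z (real (Suc n) * h)"
    by (simp add: subset_iff algebra_simps)
  then have "V a \<le> measure M (box_at z (real (Suc n) * h))"
    unfolding V_def by (rule measure_mono_fmeasurable[OF _ _ fmeasurable_box_at]) measurable
  also have "\<dots> \<le> L ^ n * V z" by (rule box_growth)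
  finally show ?thesis .
qed

text \<open>The quadratic exponent beats exponential growth: once
  \<open>c * n \<ge> ln L + 1\<close>, the terms lie below a geometric series of ratio
  \<open>exp (-1)\<close>.\<close>

lemma summable_gauss:
  assumes "0 < \<alpha>"
  shows "summable (\<lambda>n. exp (- \<alpha> * (real n * h)\<^sup>2) * L ^ n)"
proof (rule summable_comparison_test_ev)
  define c where "c = \<alpha> * h\<^sup>2"
  have c: "0 < c" using assms h_pos by (simp add: c_def)
  have "eventually (\<lambda>n. real n \<ge> (ln L + 1) / c) sequentially"
    using filterlim_real_sequentially by (simp add: filterlim_at_top)
  then show "eventually (\<lambda>n. norm (exp (- \<alpha> * (real n * h)\<^sup>2) * L ^ n) \<le> exp (-1) ^ n) sequentially"
  proof eventually_elim
    case (elim n)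
    have "L ^ n = exp (real n * ln L)"
      using L_pos by (simp add: exp_of_nat_mult)
    then have "exp (- \<alpha> * (real n * h)\<^sup>2) * L ^ n = exp (real n * (ln L - c * real n))"
      by (simp add: exp_add[symmetric] c_def power2_eq_square algebra_simps)
    also have "\<dots> \<le> exp (real n * (-1))"
    proof -
      have "ln L - c * real n \<le> -1"
        using elim c by (simp add: field_simps)
      then have "real n * (ln L - c * real n) \<le> real n * (-1)"
        by (rule mult_left_mono) simp
      then show ?thesis by simp
    qed
    also have "\<dots> = exp (-1) ^ n" by (simp add: exp_of_nat_mult[symmetric])
    finally show ?case using L_pos by simp
  qed
  show "summable (\<lambda>n. exp (- 1 :: real) ^ n)"
    by (rule summable_geometric) simp
qed

text \<open>Cut the plane into square shells of width \<open>h\<close> about \<open>a\<close>. On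
  shell \<open>n\<close> the Gaussian is at most \<open>e n\<close>, and the shell lies in a box of
  mass at most \<open>L ^ n * V a\<close>.\<close>

lemma gauss_integral_bound:
  assumes \<alpha>: "0 < \<alpha>"
  obtains G where "0 < G"
    "\<And>a. (\<integral>\<^sup>+z. ennreal (exp (- \<alpha> * (cmod (z - a))\<^sup>2)) \<partial>M) \<le> ennreal (G * V a)"
proof -
  define e where "e n = exp (- \<alpha> * (real n * h)\<^sup>2)" for n
  define G where "G = (\<Sum>n. e n * L ^ n)"
  have e0: "0 < e n" for n by (simp add: e_def)
  have sm: "summable (\<lambda>n. e n * L ^ n)"
    using summable_gauss[OF \<alpha>] by (simp add: e_def)
  have G: "0 < G"
    unfolding G_def by (rule suminf_pos[OF sm]) (use e0 L_pos in auto)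
  have "(\<integral>\<^sup>+z. ennreal (exp (- \<alpha> * (cmod (z - a))\<^sup>2)) \<partial>M) \<le> ennreal (G * V a)" for a
  proof -
    have "(\<integral>\<^sup>+z. ennreal (exp (- \<alpha> * (cmod (z - a))\<^sup>2)) \<partial>M)
        \<le> (\<integral>\<^sup>+z. (\<Sum>n. ennreal (e n) * indicator (box_at a (real (Suc n) * h)) z) \<partial>M)"
    proof (rule nn_integral_mono)
      fix z
      define m where "m = max \<bar>Re z - Re a\<bar> \<bar>Im z - Im a\<bar>"
      \<comment> \<open>The index of the shell containing \<open>z\<close>; this single term of the
        series dominates the integrand at \<open>z\<close>.\<close>
      define n where "n = nat \<lfloor>m / h\<rfloor>"
      have m0: "0 \<le> m" by (simp add: m_def)
      have "m \<le> cmod (z - a)"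
        using abs_Re_le_cmod[of "z - a"] abs_Im_le_cmod[of "z - a"] by (simp add: m_def)
      have "real n \<le> m / h" "m / h < real (Suc n)"
        using m0 h_pos by (simp_all add: n_def) linarith
      then have nm: "real n * h \<le> m" "m \<le> real (Suc n) * h"
        using h_pos by (simp_all add: field_simps)
      have zin: "z \<in> box_at a (real (Suc n) * h)"
        using nm(2) by (simp add: mem_box_at m_def)
      have "(real n * h)\<^sup>2 \<le> (cmod (z - a))\<^sup>2"
        using nm(1) \<open>m \<le> cmod (z - a)\<close> h_pos by (intro power_mono) auto
      then have "exp (- \<alpha> * (cmod (z - a))\<^sup>2) \<le> e n"
        using \<alpha> by (simp add: e_def)
      then have "ennreal (exp (- \<alpha> * (cmod (z - a))\<^sup>2)) \<le> ennreal (e n) * indicator (box_at a (real (Suc n) * h)) z"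
        using zin by (simp add: ennreal_leI)
      also have "\<dots> \<le> (\<Sum>n. ennreal (e n) * indicator (box_at a (real (Suc n) * h)) z)"
      proof -
        define f where "f n = ennreal (e n) * indicator (box_at a (real (Suc n) * h)) z" for n
        have "f n \<le> suminf f"
          using sum_le_suminf[of f "{n}"] by simp
        then show ?thesis unfolding f_def .
      qed
      finally show "ennreal (exp (- \<alpha> * (cmod (z - a))\<^sup>2)) \<le> \<dots>" .
    qed
    also have "\<dots> = (\<Sum>n. ennreal (e n) * emeasure M (box_at a (real (Suc n) * h)))"
      by (subst nn_integral_suminf) (auto simp: nn_integral_cmult)
    also have "\<dots> \<le> (\<Sum>n. ennreal (e n * L ^ n * V a))"
    proof (intro suminf_le summableI)
      fix n
      have "e n * measure M (box_at a (real (Suc n) * h)) \<le> e n * (L ^ n * V a)"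
        using box_growth[of a n] e0[of n] by (intro mult_left_mono) auto
      then show "ennreal (e n) * emeasure M (box_at a (real (Suc n) * h)) \<le> ennreal (e n * L ^ n * V a)"
        unfolding emeasure_box_at using e0[of n]
        by (simp add: ennreal_mult[symmetric] less_imp_le mult.assoc ennreal_leI)
    qed
    also have "\<dots> = ennreal (\<Sum>n. e n * L ^ n * V a)"
      by (rule suminf_ennreal2) (use e0 L_pos V_pos[of a] sm in \<open>auto intro!: summable_mult2 mult_nonneg_nonneg less_imp_le\<close>)
    also have "(\<Sum>n. e n * L ^ n * V a) = G * V a"
      using sm by (simp add: G_def suminf_mult2)
    finally show ?thesis .
  qed
  with G show thesis by (rule that)
qed

end

section \<open>Pointwise estimates for entire functions\<close>

text \<open>Cauchy's estimate on disks of radius \<open>d / 2\<close> bounds the derivative by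
  \<open>2 * B / d\<close> on the half disk; convexity turns this into a Lipschitz bound.\<close>

lemma holomorphic_bounded_lipschitz:
  fixes f :: "complex \<Rightarrow> complex"
  assumes hol: "f holomorphic_on ball c d" and cont: "continuous_on (cball c d) f" and d: "0 < d"
    and bnd: "\<And>z. z \<in> cball c d \<Longrightarrow> cmod (f z) \<le> B" and z: "cmod (z - c) \<le> d / 2"
  shows "cmod (f z - f c) \<le> 2 * B / d * cmod (z - c)"
proof (rule field_differentiable_bound[where S = "cball c (d / 2)" and f' = "deriv f"])
  show "convex (cball c (d / 2))" by simp
  fix x assume x: "x \<in> cball c (d / 2)"
  then have cx: "dist c x \<le> d / 2" by simp
  have tri: "dist c y \<le> d / 2 + dist x y" for y
    using dist_triangle[of c y x] cx by simp
  have sub: "ball x (d / 2) \<subseteq> ball c d"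
  proof
    fix y assume "y \<in> ball x (d / 2)"
    then show "y \<in> ball c d" using tri[of y] by simp
  qed
  have sub': "cball x (d / 2) \<subseteq> cball c d"
  proof
    fix y assume "y \<in> cball x (d / 2)"
    then show "y \<in> cball c d" using tri[of y] by simp
  qed
  have "x \<in> ball c d" using x d by simp
  then show "(f has_field_derivative deriv f x) (at x within cball c (d / 2))"
    by (rule has_field_derivative_at_within[OF holomorphic_derivI[OF hol open_ball]])
  have "cmod ((deriv ^^ 1) f x) \<le> fact 1 * B / (d / 2) ^ 1"
  proof (rule Cauchy_inequality)
    show "f holomorphic_on ball x (d / 2)" using hol sub by (rule holomorphic_on_subset)
    show "continuous_on (cball x (d / 2)) f" using cont sub' by (rule continuous_on_subset)
    show "0 < d / 2" using d by simp
    fix y assume "cmod (x - y) = d / 2"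
    then have "y \<in> cball x (d / 2)" by (simp add: dist_norm)
    then show "cmod (f y) \<le> B" using sub' bnd by blast
  qed
  then show "cmod (deriv f x) \<le> 2 * B / d" by (simp add: mult.commute)
qed (use d z in \<open>auto simp: dist_norm norm_minus_commute\<close>)

context subsquare_doubling
begin

lemma continuous_measurable_M:
  fixes f :: "complex \<Rightarrow> 'b::topological_space"
  assumes "continuous_on UNIV f"
  shows "f \<in> borel_measurable M"
proof -
  have "f \<in> borel_measurable lebesgue"
    using assms by (intro measurable_completion) (simp add: borel_measurable_continuous_onI)
  then show ?thesis by (simp add: measurable_cong_sets[OF sets_M refl])
qed

text \<open>Instead of the subharmonicity of \<open>|g|\<^bsup>2/p\<^esup>\<close> we use a point where
  \<open>|g(\<zeta>)|\<^sup>2 (h - |\<zeta> - z|)\<^sup>N\<close> is maximal: by Cauchy's estimate \<open>g\<close> cannot oscillate much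
  in a disk around it of radius comparable to its distance from the boundary, and the doubling
  exponent \<open>N\<close> is exactly compensated by the factor \<open>(h - |\<zeta> - z|)\<^sup>N\<close>.\<close>

lemma point_evaluation:
  obtains C where "0 < C"
    "\<And>g z. g holomorphic_on UNIV \<Longrightarrow>
       ennreal ((cmod (g z))\<^sup>2 * V z) \<le> ennreal C * (\<integral>\<^sup>+\<zeta>\<in>box_at z h. ennreal ((cmod (g \<zeta>))\<^sup>2) \<partial>M)"
proof -
  \<comment> \<open>Near \<open>u\<close> the Lipschitz constant of \<open>g\<close> will be
    \<open>2 * 2 ^ N * |g u| / d\<close>; with this \<open>\<kappa>\<close>, \<open>g\<close> varies
    by at most half of \<open>|g u|\<close> within distance \<open>\<kappa> * d\<close>.\<close>
  define \<kappa> :: real where "\<kappa> = 1 / (4 * 2 ^ N)"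
  have "(1::real) \<le> 2 ^ N" by simp
  then have "(1::real) \<le> 2 * 2 ^ N" by linarith
  then have \<kappa>: "0 < \<kappa>" "\<kappa> \<le> 1 / 2" "2 * 2 ^ N * \<kappa> = 1 / 2"
    unfolding \<kappa>_def by (simp_all add: field_simps)
  \<comment> \<open>The 4 comes from \<open>|g| \<ge> |g u| / 2\<close> on \<open>E\<close>; the
    rest is what remains of the doubling constant for \<open>E\<close> once \<open>h\<close> and
    \<open>d\<close> cancel.\<close>
  define C where "C = 4 * K * (8 / \<kappa>) ^ N"
  have C: "0 < C" using K_pos \<kappa> by (simp add: C_def)
  have main: "ennreal ((cmod (g z))\<^sup>2 * V z) \<le> ennreal C * (\<integral>\<^sup>+\<zeta>\<in>box_at z h. ennreal ((cmod (g \<zeta>))\<^sup>2) \<partial>M)"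
    if hol: "g holomorphic_on UNIV" for g z
  proof (cases "g z = 0")
    case False
    have cont: "continuous_on T g" for T
      using hol holomorphic_on_imp_continuous_on continuous_on_subset by blast
    define \<Phi> where "\<Phi> \<zeta> = (cmod (g \<zeta>))\<^sup>2 * (h - cmod (\<zeta> - z)) ^ N" for \<zeta>
    have "continuous_on (cball z h) \<Phi>"
      unfolding \<Phi>_def by (intro continuous_intros cont)
    moreover have "cball z h \<noteq> {}" using h_pos by simp
    ultimately obtain u where u: "u \<in> cball z h" and max: "\<And>\<zeta>. \<zeta> \<in> cball z h \<Longrightarrow> \<Phi> \<zeta> \<le> \<Phi> u"
      using continuous_attains_sup[OF compact_cball] by metis
    have "\<Phi> z \<le> \<Phi> u" using max h_pos by simp
    then have zu: "(cmod (g z))\<^sup>2 * h ^ N \<le> (cmod (g u))\<^sup>2 * (h - cmod (u - z)) ^ N"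
      by (simp add: \<Phi>_def)
    \<comment> \<open>Half the distance from \<open>u\<close> to the boundary circle, so
      \<open>h - |\<zeta> - z|\<close> stays at least \<open>d\<close> on
      \<open>cball u d\<close>.\<close>
    define d where "d = (h - cmod (u - z)) / 2"
    have d2: "h - cmod (u - z) = 2 * d" by (simp add: d_def)
    \<comment> \<open>On the circle \<open>\<Phi>\<close> vanishes because \<open>N > 0\<close>,
      whereas \<open>\<Phi> z > 0\<close>.\<close>
    have "cmod (u - z) \<noteq> h"
    proof
      assume "cmod (u - z) = h"
      then have "(cmod (g z))\<^sup>2 * h ^ N \<le> 0" using zu N_pos by (simp add: power_0_left)
      moreover have "0 < (cmod (g z))\<^sup>2 * h ^ N" using False h_pos by simp
      ultimately show False by simp
    qed
    then have d: "0 < d" using u by (simp add: d_def dist_norm norm_minus_commute)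
    have disk: "\<zeta> \<in> cball z h" "d \<le> h - cmod (\<zeta> - z)" if "\<zeta> \<in> cball u d" for \<zeta>
    proof -
      have "cmod (\<zeta> - u) \<le> d" using that by (simp add: dist_norm norm_minus_commute)
      then have "cmod (\<zeta> - z) \<le> d + cmod (u - z)"
        using norm_triangle_ineq[of "\<zeta> - u" "u - z"] by simp
      then show "d \<le> h - cmod (\<zeta> - z)" unfolding d_def by argo
      then show "\<zeta> \<in> cball z h" using d by (simp add: dist_norm norm_minus_commute)
    qed
    \<comment> \<open>The weight in \<open>\<Phi>\<close> is at least \<open>d ^ N\<close> at
      \<open>\<zeta>\<close> and equals \<open>(2 * d) ^ N\<close> at \<open>u\<close>, so
      maximality gives \<open>|g \<zeta>|^2 \<le> 2 ^ N * |g u|^2\<close>; the weaker bound stated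
      avoids a square root.\<close>
    have upper: "cmod (g \<zeta>) \<le> 2 ^ N * cmod (g u)" if "\<zeta> \<in> cball u d" for \<zeta>
    proof (rule power2_le_imp_le)
      have "(cmod (g \<zeta>))\<^sup>2 * d ^ N \<le> \<Phi> \<zeta>"
        unfolding \<Phi>_def using disk[OF that] d by (intro mult_left_mono power_mono) auto
      also have "\<dots> \<le> \<Phi> u" by (rule max[OF disk(1)[OF that]])
      also have "\<dots> = (cmod (g u))\<^sup>2 * 2 ^ N * d ^ N"
        by (simp add: \<Phi>_def d2 power_mult_distrib)
      finally have "(cmod (g \<zeta>))\<^sup>2 \<le> (cmod (g u))\<^sup>2 * 2 ^ N"
        using d by simp
      also have "\<dots> \<le> (cmod (g u))\<^sup>2 * (2 ^ N)\<^sup>2"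
        by (intro mult_left_mono self_le_power) auto
      finally show "(cmod (g \<zeta>))\<^sup>2 \<le> (2 ^ N * cmod (g u))\<^sup>2"
        by (simp add: power_mult_distrib mult.commute)
    qed simp
    define E where "E = box_at u (\<kappa> * d / 2)"
    have E_ball: "E \<subseteq> ball u (\<kappa> * d)"
      unfolding E_def by (rule box_at_subset_ball) (use \<kappa> d in auto)
    have lower: "(cmod (g u))\<^sup>2 / 4 \<le> (cmod (g \<zeta>))\<^sup>2" if "\<zeta> \<in> E" for \<zeta>
    proof -
      have \<zeta>: "cmod (\<zeta> - u) \<le> \<kappa> * d"
        using E_ball that by (auto simp: dist_norm norm_minus_commute)
      also have "\<dots> \<le> d / 2" using \<kappa>(2) d by (simp add: field_simps)
      finally have "cmod (g \<zeta> - g u) \<le> 2 * (2 ^ N * cmod (g u)) / d * cmod (\<zeta> - u)"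
        using holomorphic_bounded_lipschitz[OF holomorphic_on_subset[OF hol] cont d upper] by simp
      also have "\<dots> \<le> 2 * (2 ^ N * cmod (g u)) / d * (\<kappa> * d)"
        using \<zeta> d by (intro mult_left_mono) auto
      also have "\<dots> = (2 * 2 ^ N * \<kappa>) * cmod (g u)" using d by simp
      also have "\<dots> = cmod (g u) / 2" unfolding \<kappa>(3) by simp
      finally have "cmod (g u) / 2 \<le> cmod (g \<zeta>)"
        using norm_triangle_sub[of "g u" "g \<zeta>"] by (simp add: norm_minus_commute)
      then have "(cmod (g u) / 2)\<^sup>2 \<le> (cmod (g \<zeta>))\<^sup>2" by (intro power_mono) auto
      then show ?thesis by (simp add: power_divide)
    qed
    have "E \<subseteq> cball u d"
    proof -
      have "\<kappa> * d \<le> d" using \<kappa>(2) d by simp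
      then show ?thesis using E_ball by (fastforce simp: subset_iff)
    qed
    also have "\<dots> \<subseteq> cball z h" using disk(1) by blast
    also have "\<dots> \<subseteq> box_at z h" by (rule cball_subset_box_at)
    finally have Eh: "E \<subseteq> box_at z h" .
    have "box_at z h \<subseteq> box_at z (2 * h)"
      using h_pos by (auto simp: mem_box_at)
    with Eh have E2h: "E \<subseteq> box_at z (2 * h)" by (rule subset_trans)
    have "V z \<le> measure M (box_at z (2 * h))"
      unfolding V_def by (rule measure_mono_fmeasurable[OF \<open>box_at z h \<subseteq> _\<close> _ fmeasurable_box_at]) measurable
    also have "\<dots> \<le> K * (2 * h / (\<kappa> * d / 2)) ^ N * measure M E"
      using E2h \<kappa>(1) d unfolding E_def by (intro doubling_box) auto
    finally have VE: "V z \<le> K * (4 * h / (\<kappa> * d)) ^ N * measure M E" by simp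
    \<comment> \<open>Multiplying the maximality and doubling estimates eliminates the uncontrolled
      \<open>d\<close>: \<open>(2 * d) ^ N\<close> meets \<open>(\<kappa> * d) ^ N\<close> in the
      denominator.\<close>
    have "(cmod (g z))\<^sup>2 * h ^ N * V z \<le> (cmod (g u))\<^sup>2 * (2 * d) ^ N * (K * (4 * h / (\<kappa> * d)) ^ N * measure M E)"
    proof (rule mult_mono[OF _ VE])
      show "(cmod (g z))\<^sup>2 * h ^ N \<le> (cmod (g u))\<^sup>2 * (2 * d) ^ N"
        using zu by (simp add: d2)
    qed (use V_pos[of z] d in auto)
    also have "\<dots> = h ^ N * (C * ((cmod (g u))\<^sup>2 / 4 * measure M E))"
    proof -
      have "(2 * d) ^ N * (4 * h / (\<kappa> * d)) ^ N = h ^ N * (8 / \<kappa>) ^ N"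
        unfolding power_mult_distrib[symmetric] using d by (simp add: field_simps)
      then show ?thesis by (simp add: C_def)
    qed
    finally have "h ^ N * ((cmod (g z))\<^sup>2 * V z) \<le> h ^ N * (C * ((cmod (g u))\<^sup>2 / 4 * measure M E))"
      by (simp add: mult_ac)
    then have "(cmod (g z))\<^sup>2 * V z \<le> C * ((cmod (g u))\<^sup>2 / 4 * measure M E)"
      by (rule mult_left_le_imp_le) (use h_pos in simp)
    then have "ennreal ((cmod (g z))\<^sup>2 * V z) \<le> ennreal C * (ennreal ((cmod (g u))\<^sup>2 / 4) * emeasure M E)"
      using C unfolding E_def emeasure_box_at by (simp add: ennreal_mult[symmetric] ennreal_leI)
    also have "ennreal ((cmod (g u))\<^sup>2 / 4) * emeasure M E = (\<integral>\<^sup>+\<zeta>. ennreal ((cmod (g u))\<^sup>2 / 4) * indicator E \<zeta> \<partial>M)"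
      unfolding E_def by (rule nn_integral_cmult_indicator[symmetric]) measurable
    also have "\<dots> \<le> (\<integral>\<^sup>+\<zeta>\<in>box_at z h. ennreal ((cmod (g \<zeta>))\<^sup>2) \<partial>M)"
      using lower Eh by (intro nn_integral_mono) (auto simp: indicator_def intro!: ennreal_leI)
    finally show ?thesis by (simp add: mult_left_mono)
  qed simp
  from C main show thesis by (rule that)
qed

end

section \<open>Reproducing kernels of spaces of entire functions\<close>

text \<open>The locally uniform evaluation bound has two uses: norm-bounded sequences are normal
  families, and norm zero forces the zero function.\<close>

locale entire_L2 =
  fixes \<nu> :: "complex measure"
  assumes sets_\<nu>: "sets \<nu> = sets lebesgue"
    and locally_bounded_evaluation: "compact T \<Longrightarrow> \<exists>C. \<forall>f. f holomorphic_on UNIV \<longrightarrow>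
      integrable \<nu> (\<lambda>z. (cmod (f z))\<^sup>2) \<longrightarrow> (\<forall>z\<in>T. (cmod (f z))\<^sup>2 \<le> C * (LINT z|\<nu>. (cmod (f z))\<^sup>2))"
begin

definition H :: "(complex \<Rightarrow> complex) set" where
  "H = {f. f holomorphic_on UNIV \<and> integrable \<nu> (\<lambda>z. (cmod (f z))\<^sup>2)}"

definition nrm2 :: "(complex \<Rightarrow> complex) \<Rightarrow> real" where
  "nrm2 f = (LINT z|\<nu>. (cmod (f z))\<^sup>2)"

definition ip :: "(complex \<Rightarrow> complex) \<Rightarrow> (complex \<Rightarrow> complex) \<Rightarrow> complex" where
  "ip f g = (LINT z|\<nu>. f z * cnj (g z))"

lemma holomorphic_measurable:
  assumes "f holomorphic_on UNIV"
  shows "f \<in> borel_measurable \<nu>"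
proof -
  have "f \<in> borel_measurable lebesgue"
    using holomorphic_on_imp_continuous_on[OF assms]
    by (intro measurable_completion) (simp add: borel_measurable_continuous_onI)
  then show ?thesis by (simp add: measurable_cong_sets[OF sets_\<nu> refl])
qed

lemma H_measurable: "f \<in> H \<Longrightarrow> f \<in> borel_measurable \<nu>"
  by (simp add: H_def holomorphic_measurable)

lemma nrm2_nonneg: "0 \<le> nrm2 f"
  by (simp add: nrm2_def)

lemma ip_self: "ip f f = of_real (nrm2 f)"
  by (simp add: ip_def nrm2_def complex_norm_square[symmetric] flip: integral_complex_of_real)

lemma integrable_ip:
  assumes "f \<in> H" "g \<in> H"
  shows "integrable \<nu> (\<lambda>z. f z * cnj (g z))"
proof (rule Bochner_Integration.integrable_bound)
  show "integrable \<nu> (\<lambda>z. (cmod (f z))\<^sup>2 + (cmod (g z))\<^sup>2)"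
    using assms by (simp add: H_def)
  have "(\<lambda>z. cnj (g z)) \<in> borel_measurable \<nu>"
    by (rule measurable_compose[OF H_measurable[OF assms(2)]])
      (intro borel_measurable_continuous_onI continuous_intros)
  then show "(\<lambda>z. f z * cnj (g z)) \<in> borel_measurable \<nu>"
    using H_measurable[OF assms(1)] by (rule borel_measurable_times[rotated])
  have "x * y \<le> \<bar>x\<^sup>2 + y\<^sup>2\<bar>" if "0 \<le> x" "0 \<le> y" for x y :: real
    using sum_squares_bound[of x y] mult_nonneg_nonneg[OF that] by simp
  then show "AE z in \<nu>. cmod (f z * cnj (g z)) \<le> norm ((cmod (f z))\<^sup>2 + (cmod (g z))\<^sup>2)"
    by (simp add: norm_mult)
qed

lemma norm_add_mult_square:
  "(cmod (x + c * y))\<^sup>2 = (cmod x)\<^sup>2 + 2 * Re (c * (y * cnj x)) + (cmod c)\<^sup>2 * (cmod y)\<^sup>2"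
  unfolding cmod_power2 by (simp add: power2_eq_square algebra_simps)

text \<open>This one combination serves for sums, multiples and the variation of a
  minimiser.\<close>

lemma H_add_mult:
  assumes "f \<in> H" "g \<in> H"
  shows "(\<lambda>z. f z + c * g z) \<in> H"
    and "nrm2 (\<lambda>z. f z + c * g z) = nrm2 f + 2 * Re (c * ip g f) + (cmod c)\<^sup>2 * nrm2 g"
proof -
  have i: "integrable \<nu> (\<lambda>z. c * (g z * cnj (f z)))"
    by (intro integrable_mult_right integrable_ip assms)
  have fg: "integrable \<nu> (\<lambda>z. (cmod (f z))\<^sup>2)" "integrable \<nu> (\<lambda>z. (cmod (g z))\<^sup>2)"
    "f holomorphic_on UNIV" "g holomorphic_on UNIV"
    using assms by (simp_all add: H_def)
  have "integrable \<nu> (\<lambda>z. (cmod (f z))\<^sup>2 + 2 * Re (c * (g z * cnj (f z))) + (cmod c)\<^sup>2 * (cmod (g z))\<^sup>2)"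
    by (intro Bochner_Integration.integrable_add integrable_mult_right integrable_Re i fg)
  then show "(\<lambda>z. f z + c * g z) \<in> H"
    unfolding H_def mem_Collect_eq norm_add_mult_square
    by (intro conjI holomorphic_intros fg)
  have "nrm2 (\<lambda>z. f z + c * g z) = nrm2 f + 2 * (LINT z|\<nu>. Re (c * (g z * cnj (f z)))) + (cmod c)\<^sup>2 * nrm2 g"
    unfolding nrm2_def norm_add_mult_square
    using Bochner_Integration.integral_add[OF Bochner_Integration.integrable_add[OF fg(1)
          integrable_mult_right[OF integrable_Re[OF i], of 2]] integrable_mult_right[OF fg(2), of "(cmod c)\<^sup>2"]]
      Bochner_Integration.integral_add[OF fg(1) integrable_mult_right[OF integrable_Re[OF i], of 2]]
    by (simp only: integral_mult_right_zero)
  also have "(LINT z|\<nu>. Re (c * (g z * cnj (f z)))) = Re (c * ip g f)"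
    using integral_Re[OF i] by (simp add: ip_def)
  finally show "nrm2 (\<lambda>z. f z + c * g z) = nrm2 f + 2 * Re (c * ip g f) + (cmod c)\<^sup>2 * nrm2 g" .
qed

lemma H_mult:
  assumes "f \<in> H"
  shows "(\<lambda>z. c * f z) \<in> H" and "nrm2 (\<lambda>z. c * f z) = (cmod c)\<^sup>2 * nrm2 f"
proof -
  have "(\<lambda>z. 0) \<in> H" by (simp add: H_def)
  from H_add_mult[OF this assms, of c]
  show "(\<lambda>z. c * f z) \<in> H" and "nrm2 (\<lambda>z. c * f z) = (cmod c)\<^sup>2 * nrm2 f"
    by (simp_all add: ip_def nrm2_def)
qed

section \<open>Extremal functions and the reproducing kernel\<close>

text \<open>A minimising sequence is locally bounded, so Montel's theorem gives an entire limit
  along a subsequence, and Fatou's lemma shows that it attains the infimum. This stands in for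
  completeness of \<open>H\<close>.\<close>

lemma minimizer_exists:
  assumes f1: "f1 \<in> H" "f1 a \<noteq> 0"
  obtains g where "g \<in> H" "g a = 1" "0 < nrm2 g" "\<And>f. f \<in> H \<Longrightarrow> f a = 1 \<Longrightarrow> nrm2 g \<le> nrm2 f"
proof -
  define S where "S = {f \<in> H. f a = 1}"
  have "(\<lambda>z. 1 / f1 a * f1 z) \<in> S"
    unfolding S_def using H_mult(1)[OF f1(1), of "1 / f1 a"] f1(2) by simp
  then have S_ne: "nrm2 ` S \<noteq> {}" by blast
  have S_bdd: "bdd_below (nrm2 ` S)"
    by (rule bdd_belowI2[where m = 0]) (rule nrm2_nonneg)
  define m where "m = Inf (nrm2 ` S)"
  have m_le: "m \<le> nrm2 f" if "f \<in> S" for f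
    unfolding m_def using that by (intro cInf_lower S_bdd) simp
  have m0: "0 \<le> m"
    unfolding m_def by (rule cInf_greatest[OF S_ne]) (auto simp: nrm2_nonneg)
  have "\<exists>f\<in>S. nrm2 f < m + inverse (real (Suc n))" for n
    using cInf_lessD[OF S_ne, of "m + inverse (real (Suc n))"] by (auto simp: m_def)
  then obtain F where F: "\<And>n. F n \<in> S" "\<And>n. nrm2 (F n) < m + inverse (real (Suc n))"
    by metis
  have F_hol: "F n holomorphic_on UNIV" for n
    using F(1)[of n] by (simp add: S_def H_def)
  have F_bdd: "nrm2 (F n) \<le> m + 1" for n
  proof -
    have "inverse (real (Suc n)) \<le> 1" by (simp add: inverse_le_1_iff)
    then show ?thesis using F(2)[of n] by linarith
  qed
  obtain g r where g: "g holomorphic_on UNIV" and r: "strict_mono (r :: nat \<Rightarrow> nat)"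
    and lim: "\<And>x. (\<lambda>n. F (r n) x) \<longlonglongrightarrow> g x"
  proof (rule Montel[of UNIV "range F" F])
    show "open (UNIV :: complex set)" by simp
    show "h holomorphic_on UNIV" if "h \<in> range F" for h
      using that F_hol by auto
    show "\<exists>B. \<forall>h\<in>range F. \<forall>z\<in>T. cmod (h z) \<le> B" if T: "compact T" for T
    proof -
      obtain C where C: "\<And>f z. f \<in> H \<Longrightarrow> z \<in> T \<Longrightarrow> (cmod (f z))\<^sup>2 \<le> C * nrm2 f"
        using locally_bounded_evaluation[OF T] by (auto simp: H_def nrm2_def)
      \<comment> \<open>\<open>C\<close> may have either sign, hence its absolute value.\<close>
      have "cmod (F n z) \<le> sqrt (\<bar>C\<bar> * (m + 1))" if "z \<in> T" for n z
      proof (rule real_le_rsqrt)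
        have "(cmod (F n z))\<^sup>2 \<le> C * nrm2 (F n)"
          using C F(1)[of n] that by (simp add: S_def)
        also have "\<dots> \<le> \<bar>C\<bar> * (m + 1)"
          using F_bdd[of n] nrm2_nonneg[of "F n"] by (intro mult_mono) auto
        finally show "(cmod (F n z))\<^sup>2 \<le> \<bar>C\<bar> * (m + 1)" .
      qed
      then show ?thesis by blast
    qed
  qed auto
  have ga: "g a = 1"
    using lim[of a] F(1) LIMSEQ_unique[OF _ tendsto_const[of "1::complex"]] by (simp add: S_def)
  have "(\<lambda>n. nrm2 (F n)) \<longlonglongrightarrow> m"
  proof (rule real_tendsto_sandwich)
    show "\<forall>\<^sub>F n in sequentially. m \<le> nrm2 (F n)"
      using m_le F(1) by simp
    show "\<forall>\<^sub>F n in sequentially. nrm2 (F n) \<le> m + inverse (real (Suc n))"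
      using F(2) by (simp add: less_imp_le)
    show "(\<lambda>n. m + inverse (real (Suc n))) \<longlonglongrightarrow> m"
      using tendsto_add[OF tendsto_const LIMSEQ_inverse_real_of_nat, of m] by simp
  qed simp
  then have "(\<lambda>n. nrm2 (F (r n))) \<longlonglongrightarrow> m"
    using LIMSEQ_subseq_LIMSEQ[OF _ r] by (simp add: o_def)
  then have lim_nrm: "(\<lambda>n. ennreal (nrm2 (F (r n)))) \<longlonglongrightarrow> ennreal m"
    by (rule tendsto_ennrealI)
  have nn: "(\<integral>\<^sup>+z. ennreal ((cmod (F n z))\<^sup>2) \<partial>\<nu>) = ennreal (nrm2 (F n))" for n
    unfolding nrm2_def by (rule nn_integral_eq_integral) (use F(1)[of n] in \<open>auto simp: S_def H_def\<close>)
  note [measurable] = holomorphic_measurable[OF F_hol] holomorphic_measurable[OF g]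
  have "(\<integral>\<^sup>+z. ennreal ((cmod (g z))\<^sup>2) \<partial>\<nu>) = (\<integral>\<^sup>+z. liminf (\<lambda>n. ennreal ((cmod (F (r n) z))\<^sup>2)) \<partial>\<nu>)"
  proof (rule nn_integral_cong)
    fix z
    have "(\<lambda>n. ennreal ((cmod (F (r n) z))\<^sup>2)) \<longlonglongrightarrow> ennreal ((cmod (g z))\<^sup>2)"
      by (intro tendsto_ennrealI tendsto_intros lim)
    then show "ennreal ((cmod (g z))\<^sup>2) = liminf (\<lambda>n. ennreal ((cmod (F (r n) z))\<^sup>2))"
      by (rule lim_imp_Liminf[OF sequentially_bot, symmetric])
  qed
  also have "\<dots> \<le> liminf (\<lambda>n. \<integral>\<^sup>+z. ennreal ((cmod (F (r n) z))\<^sup>2) \<partial>\<nu>)"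
    by (rule nn_integral_liminf) measurable
  also have "\<dots> = ennreal m"
    unfolding nn by (rule lim_imp_Liminf[OF _ lim_nrm]) simp
  finally have le: "(\<integral>\<^sup>+z. ennreal ((cmod (g z))\<^sup>2) \<partial>\<nu>) \<le> ennreal m" .
  then have gH: "g \<in> H"
    unfolding H_def using g by (auto intro!: integrableI_nonneg order_le_less_trans[OF le])
  have "ennreal (nrm2 g) \<le> ennreal m"
    using le unfolding nrm2_def
    by (subst nn_integral_eq_integral[symmetric]) (use gH in \<open>auto simp: H_def\<close>)
  then have gm: "nrm2 g \<le> m" using m0 by simp
  \<comment> \<open>Norm zero would force \<open>g a = 0\<close> by the evaluation bound at
    \<open>a\<close>.\<close>
  have "0 < nrm2 g"
  proof (rule ccontr)
    assume "\<not> 0 < nrm2 g"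
    then have "nrm2 g = 0" using nrm2_nonneg[of g] by simp
    moreover obtain C where "\<forall>f. f \<in> H \<longrightarrow> (cmod (f a))\<^sup>2 \<le> C * nrm2 f"
      using locally_bounded_evaluation[of "{a}"] by (auto simp: H_def nrm2_def)
    ultimately show False using gH ga by fastforce
  qed
  moreover have "nrm2 g \<le> nrm2 f" if "f \<in> H" "f a = 1" for f
    using gm m_le[of f] that by (simp add: S_def)
  ultimately show thesis using that gH ga by blast
qed

text \<open>First variation: \<open>g + c * u\<close> still has value 1 at \<open>a\<close>, so the
  term linear in \<open>c\<close> cannot lower the norm and must vanish.\<close>

lemma minimizer_orthogonal:
  assumes g: "g \<in> H" "g a = 1" and min: "\<And>f. f \<in> H \<Longrightarrow> f a = 1 \<Longrightarrow> nrm2 g \<le> nrm2 f"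
    and u: "u \<in> H" "u a = 0"
  shows "ip u g = 0"
proof -
  define q where "q = (cmod (ip u g))\<^sup>2"
  \<comment> \<open>Small enough to keep the quadratic term below half of the linear one; the
    \<open>+ 1\<close> covers \<open>nrm2 u = 0\<close>.\<close>
  define \<epsilon> where "\<epsilon> = 1 / (nrm2 u + 1)"
  have \<epsilon>: "0 < \<epsilon>" "\<epsilon> * nrm2 u < 1"
    using nrm2_nonneg[of u] by (simp_all add: \<epsilon>_def field_simps)
  \<comment> \<open>The phase makes the cross term real and at most 0.\<close>
  define c where "c = - of_real \<epsilon> * cnj (ip u g)"
  have "c * ip u g = of_real (- (\<epsilon> * q))"
    by (simp add: c_def q_def complex_norm_square[symmetric] mult.commute[of "cnj _"] mult.assoc
        del: of_real_power)
  then have re: "Re (c * ip u g) = - (\<epsilon> * q)" by (simp only: Re_complex_of_real)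
  have cc: "(cmod c)\<^sup>2 = \<epsilon> * (\<epsilon> * q)"
    by (simp add: c_def q_def norm_mult power_mult_distrib power2_eq_square)
  have "nrm2 g \<le> nrm2 (\<lambda>z. g z + c * u z)"
    by (rule min) (use H_add_mult(1)[OF g(1) u(1)] g u in auto)
  also have "\<dots> = nrm2 g - 2 * (\<epsilon> * q) + (\<epsilon> * q) * (\<epsilon> * nrm2 u)"
    unfolding H_add_mult(2)[OF g(1) u(1)] re cc by simp
  finally have "2 * (\<epsilon> * q) \<le> (\<epsilon> * q) * (\<epsilon> * nrm2 u)" by simp
  also have "\<dots> \<le> (\<epsilon> * q) * 1"
    using \<epsilon> by (intro mult_left_mono) (auto simp: q_def)
  finally have "\<epsilon> * q \<le> 0" by simp
  then have "q \<le> 0" using \<epsilon> by (simp add: mult_le_0_iff)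
  then show ?thesis by (simp add: q_def)
qed

text \<open>The kernel is the minimiser divided by its squared norm: \<open>f - f a * g\<close>
  vanishes at \<open>a\<close>, hence is orthogonal to \<open>g\<close>. The last property, a
  Cauchy-Schwarz bound, comes from minimality against \<open>f / f a\<close>.\<close>

lemma reproducing_kernel_exists:
  assumes f1: "f1 \<in> H" "f1 a \<noteq> 0"
  obtains B where "B \<in> H" "\<And>f. f \<in> H \<Longrightarrow> f a = ip f B"
    "\<And>f. f \<in> H \<Longrightarrow> (cmod (f a))\<^sup>2 \<le> nrm2 B * nrm2 f"
proof -
  obtain g where g: "g \<in> H" "g a = 1" "0 < nrm2 g"
    and min: "\<And>f. f \<in> H \<Longrightarrow> f a = 1 \<Longrightarrow> nrm2 g \<le> nrm2 f"
    using that by (rule minimizer_exists[OF f1])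
  define m where "m = nrm2 g"
  have m: "0 < m" using g by (simp add: m_def)
  define B where "B z = of_real (1 / m) * g z" for z
  have BH: "B \<in> H" unfolding B_def by (rule H_mult(1)[OF g(1)])
  have nB: "nrm2 B = 1 / m"
    unfolding B_def H_mult(2)[OF g(1)] using m by (simp add: m_def norm_divide power2_eq_square)
  have rep: "f a = ip f B" if f: "f \<in> H" for f
  proof -
    have "ip (\<lambda>z. f z + (- f a) * g z) g = 0"
      by (rule minimizer_orthogonal[OF g(1,2) min]) (use H_add_mult(1)[OF f g(1), of "- f a"] g in auto)
    also have "ip (\<lambda>z. f z + (- f a) * g z) g
        = (LINT z|\<nu>. f z * cnj (g z) + (- f a) * (g z * cnj (g z)))"
      unfolding ip_def by (simp add: algebra_simps)
    also have "\<dots> = ip f g + (- f a) * ip g g"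
      unfolding ip_def using integrable_ip[OF f g(1)] integrable_ip[OF g(1) g(1)]
      by (subst Bochner_Integration.integral_add) auto
    finally have "ip f g = f a * of_real m"
      by (simp add: ip_self m_def)
    moreover have "ip f B = of_real (1 / m) * ip f g"
    proof -
      have "(\<lambda>z. f z * cnj (B z)) = (\<lambda>z. of_real (1 / m) * (f z * cnj (g z)))"
        by (simp add: B_def fun_eq_iff)
      then show ?thesis unfolding ip_def by (simp only: integral_mult_right_zero)
    qed
    ultimately show ?thesis using m by simp
  qed
  have "(cmod (f a))\<^sup>2 \<le> nrm2 B * nrm2 f" if f: "f \<in> H" for f
  proof (cases "f a = 0")
    case False
    have "m \<le> nrm2 (\<lambda>z. 1 / f a * f z)"
      unfolding m_def by (rule min) (use H_mult(1)[OF f, of "1 / f a"] False in auto)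
    also have "\<dots> = nrm2 f / (cmod (f a))\<^sup>2"
      unfolding H_mult(2)[OF f] by (simp add: norm_divide power_divide)
    finally show ?thesis using m False by (simp add: nB field_simps)
  qed (simp add: nrm2_nonneg)
  with BH rep show thesis by (rule that)
qed

text \<open>Both kernels represent the value of their difference at \<open>a\<close>, so the
  difference is orthogonal to itself. The evaluation bound turns norm zero into equality at every
  point.\<close>

lemma reproducing_kernel_unique:
  assumes "B \<in> H" "\<And>f. f \<in> H \<Longrightarrow> f a = ip f B"
    and "B' \<in> H" "\<And>f. f \<in> H \<Longrightarrow> f a = ip f B'"
  shows "B = B'"
proof -
  define D where "D z = B z + (- 1) * B' z" for z
  have D: "D \<in> H" unfolding D_def by (rule H_add_mult(1)[OF assms(1,3)])
  have "ip D D = (LINT z|\<nu>. D z * cnj (B z) - D z * cnj (B' z))"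
    unfolding ip_def by (simp add: D_def algebra_simps)
  also have "\<dots> = ip D B - ip D B'"
    unfolding ip_def by (rule Bochner_Integration.integral_diff) (intro integrable_ip D assms)+
  also have "\<dots> = 0"
    using assms(2)[OF D] assms(4)[OF D] by simp
  finally have nD: "nrm2 D = 0" by (simp add: ip_self)
  show ?thesis
  proof
    fix z
    obtain C where "\<And>f. f \<in> H \<Longrightarrow> (cmod (f z))\<^sup>2 \<le> C * nrm2 f"
      using locally_bounded_evaluation[of "{z}"] by (auto simp: H_def nrm2_def)
    from this[OF D] have "D z = 0" by (simp add: nD)
    then show "B z = B' z" by (simp add: D_def)
  qed
qed

end

section \<open>Weighted Fock spaces\<close>

context subsquare_doubling
begin

definition gauss :: "real \<Rightarrow> complex measure" where
  "gauss \<alpha> = density M (\<lambda>z. ennreal (exp (- \<alpha> * (cmod z)\<^sup>2)))"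

lemma gauss_weight_measurable: "(\<lambda>z. exp (- \<alpha> * (cmod z)\<^sup>2)) \<in> borel_measurable M"
  by (intro continuous_measurable_M continuous_intros)

lemma entire_norm_measurable:
  assumes "f holomorphic_on UNIV"
  shows "(\<lambda>z. (cmod (f z))\<^sup>2) \<in> borel_measurable M"
  using holomorphic_on_imp_continuous_on[OF assms]
  by (intro continuous_measurable_M continuous_intros)

lemma nn_integral_gauss:
  assumes "f holomorphic_on UNIV"
  shows "(\<integral>\<^sup>+z. ennreal ((cmod (f z))\<^sup>2) \<partial>gauss \<alpha>)
       = (\<integral>\<^sup>+z. ennreal (exp (- \<alpha> * (cmod z)\<^sup>2) * (cmod (f z))\<^sup>2) \<partial>M)"
proof -
  note [measurable] = gauss_weight_measurable entire_norm_measurable[OF assms]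
  have "(\<integral>\<^sup>+z. ennreal ((cmod (f z))\<^sup>2) \<partial>gauss \<alpha>)
      = (\<integral>\<^sup>+z. ennreal (exp (- \<alpha> * (cmod z)\<^sup>2)) * ennreal ((cmod (f z))\<^sup>2) \<partial>M)"
    unfolding gauss_def by (rule nn_integral_density) measurable
  then show ?thesis by (simp only: ennreal_mult exp_ge_zero zero_le_power2)
qed

text \<open>Completes the square in \<open>2 * Re (cnj a * z)\<close>. Positive
  \<open>\<beta>\<close> gives the test function centred at \<open>a\<close>; negative
  \<open>\<beta>\<close> removes growth near \<open>a\<close>.\<close>

lemma cmod_exp_twist_square:
  "(cmod (exp (of_real \<beta> * (cnj a * z))))\<^sup>2
     = exp (\<beta> * (cmod a)\<^sup>2) * exp (\<beta> * (cmod z)\<^sup>2) * exp (- \<beta> * (cmod (z - a))\<^sup>2)"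
proof -
  have "2 * (\<beta> * Re (cnj a * z)) = \<beta> * (cmod a)\<^sup>2 + \<beta> * (cmod z)\<^sup>2 + - \<beta> * (cmod (z - a))\<^sup>2"
    unfolding cmod_power2 by (simp add: power2_eq_square algebra_simps)
  moreover have "(cmod (exp (of_real \<beta> * (cnj a * z))))\<^sup>2 = exp (2 * (\<beta> * Re (cnj a * z)))"
    by (simp add: norm_exp_eq_Re exp_double)
  ultimately show ?thesis by (simp only: exp_add)
qed

text \<open>A zero-free exponential factor flattens the Gaussian near \<open>z\<close>: on the box
  the twisted and the weighted modulus agree up to a constant and a bounded factor, so the
  unweighted estimate applies.\<close>

lemma fock_evaluation:
  assumes \<alpha>: "0 < \<alpha>"
  obtains C where "0 < C"
    "\<And>f z. f holomorphic_on UNIV \<Longrightarrow> integrable (gauss \<alpha>) (\<lambda>z. (cmod (f z))\<^sup>2) \<Longrightarrow>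
       (cmod (f z))\<^sup>2 * exp (- \<alpha> * (cmod z)\<^sup>2) * V z \<le> C * (LINT \<zeta>|gauss \<alpha>. (cmod (f \<zeta>))\<^sup>2)"
proof -
  obtain C0 where C0: "0 < C0" and ev: "\<And>g z. g holomorphic_on UNIV \<Longrightarrow>
       ennreal ((cmod (g z))\<^sup>2 * V z) \<le> ennreal C0 * (\<integral>\<^sup>+\<zeta>\<in>box_at z h. ennreal ((cmod (g \<zeta>))\<^sup>2) \<partial>M)"
    using that by (rule point_evaluation)
  \<comment> \<open>The leftover factor is bounded because
    \<open>|\<zeta> - z|^2 \<le> 2 * h^2\<close> on the box.\<close>
  define C where "C = C0 * exp (\<alpha> * (2 * h\<^sup>2))"
  have C: "0 < C" using C0 by (simp add: C_def)
  have "(cmod (f z))\<^sup>2 * exp (- \<alpha> * (cmod z)\<^sup>2) * V z \<le> C * (LINT \<zeta>|gauss \<alpha>. (cmod (f \<zeta>))\<^sup>2)"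
    if f: "f holomorphic_on UNIV" and int: "integrable (gauss \<alpha>) (\<lambda>z. (cmod (f z))\<^sup>2)" for f z
  proof -
    define I where "I = (LINT \<zeta>|gauss \<alpha>. (cmod (f \<zeta>))\<^sup>2)"
    have I0: "0 \<le> I" by (simp add: I_def)
    have nnI: "(\<integral>\<^sup>+\<zeta>. ennreal (exp (- \<alpha> * (cmod \<zeta>)\<^sup>2) * (cmod (f \<zeta>))\<^sup>2) \<partial>M) = ennreal I"
      unfolding I_def nn_integral_gauss[OF f, symmetric] by (rule nn_integral_eq_integral[OF int]) simp
    define e where "e = exp (- \<alpha> * (cmod z)\<^sup>2)"
    have e0: "0 < e" by (simp add: e_def)
    define g where "g \<zeta> = f \<zeta> * exp (of_real (- \<alpha>) * (cnj z * \<zeta>))" for \<zeta>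
    have g: "g holomorphic_on UNIV"
      unfolding g_def by (intro holomorphic_intros f)
    have gsq: "(cmod (g \<zeta>))\<^sup>2 = (exp (- \<alpha> * (cmod \<zeta>)\<^sup>2) * (cmod (f \<zeta>))\<^sup>2) * (e * exp (\<alpha> * (cmod (\<zeta> - z))\<^sup>2))" for \<zeta>
      unfolding g_def norm_mult power_mult_distrib cmod_exp_twist_square by (simp add: e_def)
    have "(\<integral>\<^sup>+\<zeta>\<in>box_at z h. ennreal ((cmod (g \<zeta>))\<^sup>2) \<partial>M)
        \<le> (\<integral>\<^sup>+\<zeta>. ennreal (e * exp (\<alpha> * (2 * h\<^sup>2))) * ennreal (exp (- \<alpha> * (cmod \<zeta>)\<^sup>2) * (cmod (f \<zeta>))\<^sup>2) \<partial>M)"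
    proof (rule nn_integral_mono)
      fix \<zeta>
      have "(cmod (g \<zeta>))\<^sup>2 \<le> (e * exp (\<alpha> * (2 * h\<^sup>2))) * (exp (- \<alpha> * (cmod \<zeta>)\<^sup>2) * (cmod (f \<zeta>))\<^sup>2)"
        if "\<zeta> \<in> box_at z h"
      proof -
        have "exp (\<alpha> * (cmod (\<zeta> - z))\<^sup>2) \<le> exp (\<alpha> * (2 * h\<^sup>2))"
          using norm_le_of_mem_box_at[OF that] \<alpha> by simp
        then have "(exp (- \<alpha> * (cmod \<zeta>)\<^sup>2) * (cmod (f \<zeta>))\<^sup>2) * (e * exp (\<alpha> * (cmod (\<zeta> - z))\<^sup>2))
            \<le> (exp (- \<alpha> * (cmod \<zeta>)\<^sup>2) * (cmod (f \<zeta>))\<^sup>2) * (e * exp (\<alpha> * (2 * h\<^sup>2)))"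
          using e0 by (intro mult_left_mono) auto
        then show ?thesis unfolding gsq by (simp only: mult_ac)
      qed
      then show "ennreal ((cmod (g \<zeta>))\<^sup>2) * indicator (box_at z h) \<zeta>
          \<le> ennreal (e * exp (\<alpha> * (2 * h\<^sup>2))) * ennreal (exp (- \<alpha> * (cmod \<zeta>)\<^sup>2) * (cmod (f \<zeta>))\<^sup>2)"
        using e0 by (cases "\<zeta> \<in> box_at z h") (simp_all add: ennreal_mult[symmetric] ennreal_leI)
    qed
    also have "\<dots> = ennreal (e * exp (\<alpha> * (2 * h\<^sup>2))) * ennreal I"
      unfolding nnI[symmetric] using gauss_weight_measurable entire_norm_measurable[OF f]
      by (intro nn_integral_cmult measurable_compose[OF borel_measurable_times measurable_ennreal])
    finally have "ennreal ((cmod (g z))\<^sup>2 * V z) \<le> ennreal C0 * (ennreal (e * exp (\<alpha> * (2 * h\<^sup>2))) * ennreal I)"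
      using ev[OF g, of z] by (meson mult_left_mono order_trans zero_le)
    also have "\<dots> = ennreal (e * (C * I))"
      using C0 e0 I0 by (simp add: ennreal_mult[symmetric] C_def mult_ac)
    finally have "(cmod (g z))\<^sup>2 * V z \<le> e * (C * I)"
      using C e0 I0 by (subst (asm) ennreal_le_iff) auto
    then have "e * ((cmod (f z))\<^sup>2 * e * V z) \<le> e * (C * I)"
      unfolding gsq by (simp add: e_def mult_ac)
    then show ?thesis
      using e0 by (simp add: e_def I_def)
  qed
  with C show thesis by (rule that)
qed

text \<open>On a compact set the Gaussian is bounded below, and so is \<open>V\<close> by comparison
  with \<open>V 0\<close>; the evaluation bound thus becomes uniform there.\<close>

lemma entire_L2_gauss:
  assumes \<alpha>: "0 < \<alpha>"
  shows "entire_L2 (gauss \<alpha>)"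
proof
  show "sets (gauss \<alpha>) = sets lebesgue"
    by (simp add: gauss_def sets_M)
  obtain C where C: "0 < C" and ev:
    "\<And>f z. f holomorphic_on UNIV \<Longrightarrow> integrable (gauss \<alpha>) (\<lambda>z. (cmod (f z))\<^sup>2) \<Longrightarrow>
       (cmod (f z))\<^sup>2 * exp (- \<alpha> * (cmod z)\<^sup>2) * V z \<le> C * (LINT \<zeta>|gauss \<alpha>. (cmod (f \<zeta>))\<^sup>2)"
    using that by (rule fock_evaluation[OF \<alpha>])
  fix T :: "complex set" assume "compact T"
  then obtain R where R: "\<And>z. z \<in> T \<Longrightarrow> cmod z \<le> R"
    using compact_imp_bounded bounded_iff by metis
  define n where "n = nat \<lceil>R / h\<rceil>"
  have "R / h \<le> real n" by (simp add: n_def real_nat_ceiling_ge)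
  then have Rn: "R \<le> real n * h" using h_pos by (simp add: field_simps)
  define v where "v = exp (- \<alpha> * R\<^sup>2) * (V 0 / L ^ n)"
  have v: "0 < v" using V_pos[of 0] L_pos by (simp add: v_def)
  have "(cmod (f z))\<^sup>2 \<le> C / v * (LINT \<zeta>|gauss \<alpha>. (cmod (f \<zeta>))\<^sup>2)"
    if f: "f holomorphic_on UNIV" "integrable (gauss \<alpha>) (\<lambda>z. (cmod (f z))\<^sup>2)" and z: "z \<in> T" for f z
  proof -
    have "V 0 \<le> L ^ n * V z"
      using V_compare[of 0 z n] R[OF z] Rn by simp
    then have "V 0 / L ^ n \<le> V z" using L_pos by (simp add: field_simps)
    moreover have "(cmod z)\<^sup>2 \<le> R\<^sup>2" using R[OF z] by (intro power_mono) auto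
    then have "exp (- \<alpha> * R\<^sup>2) \<le> exp (- \<alpha> * (cmod z)\<^sup>2)" using \<alpha> by simp
    ultimately have "v \<le> exp (- \<alpha> * (cmod z)\<^sup>2) * V z"
      unfolding v_def using V_pos[of 0] L_pos by (intro mult_mono) auto
    then have "(cmod (f z))\<^sup>2 * v \<le> (cmod (f z))\<^sup>2 * (exp (- \<alpha> * (cmod z)\<^sup>2) * V z)"
      by (rule mult_left_mono) simp
    also have "\<dots> \<le> C * (LINT \<zeta>|gauss \<alpha>. (cmod (f \<zeta>))\<^sup>2)"
      using ev[OF f, of z] by (simp add: mult.assoc)
    finally show ?thesis using v by (simp add: field_simps)
  qed
  then show "\<exists>C. \<forall>f. f holomorphic_on UNIV \<longrightarrow> integrable (gauss \<alpha>) (\<lambda>z. (cmod (f z))\<^sup>2) \<longrightarrow>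
      (\<forall>z\<in>T. (cmod (f z))\<^sup>2 \<le> C * (LINT z|gauss \<alpha>. (cmod (f z))\<^sup>2))"
    by blast
qed

text \<open>Against the weight, the squared modulus becomes a Gaussian centred at \<open>a\<close>
  times \<open>exp (\<alpha> * |a|^2)\<close>, so the Gaussian average of \<open>M\<close> controls
  the norm.\<close>

lemma test_function:
  assumes \<alpha>: "0 < \<alpha>"
  obtains G where "0 < G"
    "\<And>a. integrable (gauss \<alpha>) (\<lambda>z. (cmod (exp (of_real \<alpha> * (cnj a * z))))\<^sup>2)"
    "\<And>a. (LINT z|gauss \<alpha>. (cmod (exp (of_real \<alpha> * (cnj a * z))))\<^sup>2) \<le> exp (\<alpha> * (cmod a)\<^sup>2) * (G * V a)"
proof -
  obtain G where G: "0 < G" and gb: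
    "\<And>a. (\<integral>\<^sup>+z. ennreal (exp (- \<alpha> * (cmod (z - a))\<^sup>2)) \<partial>M) \<le> ennreal (G * V a)"
    using that by (rule gauss_integral_bound[OF \<alpha>])
  interpret entire_L2 "gauss \<alpha>" by (rule entire_L2_gauss[OF \<alpha>])
  have nn: "(\<integral>\<^sup>+z. ennreal ((cmod (exp (of_real \<alpha> * (cnj a * z))))\<^sup>2) \<partial>gauss \<alpha>)
      \<le> ennreal (exp (\<alpha> * (cmod a)\<^sup>2) * (G * V a))" for a
  proof -
    have "(\<integral>\<^sup>+z. ennreal ((cmod (exp (of_real \<alpha> * (cnj a * z))))\<^sup>2) \<partial>gauss \<alpha>)
       = (\<integral>\<^sup>+z. ennreal (exp (- \<alpha> * (cmod z)\<^sup>2) * (cmod (exp (of_real \<alpha> * (cnj a * z))))\<^sup>2) \<partial>M)"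
      by (intro nn_integral_gauss holomorphic_intros)
    also have "\<dots> = (\<integral>\<^sup>+z. ennreal (exp (\<alpha> * (cmod a)\<^sup>2)) * ennreal (exp (- \<alpha> * (cmod (z - a))\<^sup>2)) \<partial>M)"
    proof (rule nn_integral_cong)
      fix z
      have "exp (- \<alpha> * (cmod z)\<^sup>2) * exp (\<alpha> * (cmod z)\<^sup>2) = 1"
        by (simp flip: exp_add)
      then have "exp (- \<alpha> * (cmod z)\<^sup>2) * (exp (\<alpha> * (cmod a)\<^sup>2) * exp (\<alpha> * (cmod z)\<^sup>2) * exp (- \<alpha> * (cmod (z - a))\<^sup>2))
          = exp (\<alpha> * (cmod a)\<^sup>2) * exp (- \<alpha> * (cmod (z - a))\<^sup>2)"
        by algebra
      then show "ennreal (exp (- \<alpha> * (cmod z)\<^sup>2) * (cmod (exp (of_real \<alpha> * (cnj a * z))))\<^sup>2)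
          = ennreal (exp (\<alpha> * (cmod a)\<^sup>2)) * ennreal (exp (- \<alpha> * (cmod (z - a))\<^sup>2))"
        unfolding cmod_exp_twist_square by (simp only: ennreal_mult exp_ge_zero)
    qed
    also have "\<dots> = ennreal (exp (\<alpha> * (cmod a)\<^sup>2)) * (\<integral>\<^sup>+z. ennreal (exp (- \<alpha> * (cmod (z - a))\<^sup>2)) \<partial>M)"
      by (intro nn_integral_cmult measurable_compose[OF _ measurable_ennreal]
          continuous_measurable_M continuous_intros)
    also have "\<dots> \<le> ennreal (exp (\<alpha> * (cmod a)\<^sup>2)) * ennreal (G * V a)"
      by (intro mult_left_mono gb) simp
    also have "\<dots> = ennreal (exp (\<alpha> * (cmod a)\<^sup>2) * (G * V a))"
      using G V_pos[of a] by (simp add: ennreal_mult[symmetric])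
    finally show ?thesis .
  qed
  have int: "integrable (gauss \<alpha>) (\<lambda>z. (cmod (exp (of_real \<alpha> * (cnj a * z))))\<^sup>2)" for a
  proof (rule integrableI_nonneg)
    have "(\<lambda>z. exp (of_real \<alpha> * (cnj a * z))) \<in> borel_measurable (gauss \<alpha>)"
      by (intro holomorphic_measurable holomorphic_intros)
    then show "(\<lambda>z. (cmod (exp (of_real \<alpha> * (cnj a * z))))\<^sup>2) \<in> borel_measurable (gauss \<alpha>)"
      by measurable
  qed (use order_le_less_trans[OF nn] in auto)
  have "(LINT z|gauss \<alpha>. (cmod (exp (of_real \<alpha> * (cnj a * z))))\<^sup>2) \<le> exp (\<alpha> * (cmod a)\<^sup>2) * (G * V a)" for a
  proof -
    have "ennreal (LINT z|gauss \<alpha>. (cmod (exp (of_real \<alpha> * (cnj a * z))))\<^sup>2)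
        \<le> ennreal (exp (\<alpha> * (cmod a)\<^sup>2) * (G * V a))"
      using nn[of a] nn_integral_eq_integral[OF int[of a]] by simp
    then show ?thesis
      using G V_pos[of a] by (subst (asm) ennreal_le_iff) auto
  qed
  with G int show thesis by (rule that)
qed

text \<open>Passes from the fixed scale \<open>h\<close> to an arbitrary radius: a small box inside
  the disk is compared with the ambient box by doubling, and \<open>r\<close> affects only
  \<open>C\<close>.\<close>

lemma V_le_ball:
  assumes "0 < r"
  obtains C where "0 < C" "\<And>a. V a \<le> C * measure M (ball a r)"
proof -
  define s where "s = min (r / 2) h"
  have s: "0 < s" "2 * s \<le> r" "s \<le> h"
    using assms h_pos by (auto simp: s_def min_def)
  define C where "C = K * (2 * h / s) ^ N"
  have C: "0 < C" using K_pos h_pos s by (simp add: C_def)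
  have "V a \<le> C * measure M (ball a r)" for a
  proof -
    have hs: "box_at a h \<subseteq> box_at a (2 * h)" "box_at a s \<subseteq> box_at a (2 * h)"
      using s h_pos by (auto simp: mem_box_at)
    have "V a \<le> measure M (box_at a (2 * h))"
      unfolding V_def by (rule measure_mono_fmeasurable[OF hs(1) _ fmeasurable_box_at]) measurable
    also have "\<dots> \<le> C * measure M (box_at a s)"
      unfolding C_def by (rule doubling_box[OF s(1) hs(2)])
    also have "\<dots> \<le> C * measure M (ball a r)"
    proof (intro mult_left_mono measure_mono_fmeasurable)
      show "box_at a s \<subseteq> ball a r" by (rule box_at_subset_ball[OF s(1,2)])
      have "ball a r \<in> sets M" by (simp add: sets_M)
      moreover have "ball a r \<subseteq> box_at a r"
        using cball_subset_box_at[of a r] by auto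
      ultimately show "ball a r \<in> fmeasurable M"
        by (rule fmeasurableI2[OF fmeasurable_box_at, rotated])
    qed (use C in auto)
    finally show ?thesis .
  qed
  with C show thesis by (rule that)
qed

text \<open>The kernel enters through two facts: its value at \<open>a\<close> is its squared norm,
  which with the evaluation bound limits that norm from above, and it is extremal, which with the
  test function limits it from below.\<close>

lemma kernel_lower_bound:
  assumes \<alpha>: "0 < \<alpha>"
  obtains \<delta> c where "0 < \<delta>" "\<delta> < 1" "0 < c"
    "\<And>a z B. B \<in> entire_L2.H (gauss \<alpha>) \<Longrightarrow>
       (\<And>f. f \<in> entire_L2.H (gauss \<alpha>) \<Longrightarrow>
          (cmod (f a))\<^sup>2 \<le> entire_L2.nrm2 (gauss \<alpha>) B * entire_L2.nrm2 (gauss \<alpha>) f) \<Longrightarrow>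
       B a = of_real (entire_L2.nrm2 (gauss \<alpha>) B) \<Longrightarrow> z \<in> ball a \<delta> \<Longrightarrow>
       c * exp (\<alpha> / 2 * (cmod a)\<^sup>2 + \<alpha> / 2 * (cmod z)\<^sup>2) \<le> cmod (B z) * V a"
proof -
  interpret entire_L2 "gauss \<alpha>" by (rule entire_L2_gauss[OF \<alpha>])
  obtain C where C: "0 < C" and ev_int:
    "\<And>f z. f holomorphic_on UNIV \<Longrightarrow> integrable (gauss \<alpha>) (\<lambda>z. (cmod (f z))\<^sup>2) \<Longrightarrow>
       (cmod (f z))\<^sup>2 * exp (- \<alpha> * (cmod z)\<^sup>2) * V z \<le> C * (LINT \<zeta>|gauss \<alpha>. (cmod (f \<zeta>))\<^sup>2)"
    using that by (rule fock_evaluation[OF \<alpha>])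
  have ev: "(cmod (f z))\<^sup>2 * exp (- \<alpha> * (cmod z)\<^sup>2) * V z \<le> C * nrm2 f" if "f \<in> H" for f z
    using ev_int that unfolding H_def nrm2_def by blast
  obtain G where G: "0 < G" and test_int:
    "\<And>a. integrable (gauss \<alpha>) (\<lambda>z. (cmod (exp (of_real \<alpha> * (cnj a * z))))\<^sup>2)"
    and test_int_le: "\<And>a. (LINT z|gauss \<alpha>. (cmod (exp (of_real \<alpha> * (cnj a * z))))\<^sup>2) \<le> exp (\<alpha> * (cmod a)\<^sup>2) * (G * V a)"
    using that by (rule test_function[OF \<alpha>])
  have test_le: "nrm2 (\<lambda>z. exp (of_real \<alpha> * (cnj a * z))) \<le> exp (\<alpha> * (cmod a)\<^sup>2) * (G * V a)" for a
    unfolding nrm2_def by (rule test_int_le)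
  have test_H: "(\<lambda>z. exp (of_real \<alpha> * (cnj a * z))) \<in> H" for a
    unfolding H_def by (intro CollectI conjI holomorphic_intros test_int)
  \<comment> \<open>\<open>P / V a\<close> will bound the twisted kernel on
    \<open>cball a h\<close>: \<open>L\<close> compares \<open>V\<close> at two points, one
    \<open>C\<close> comes from evaluating \<open>B\<close>, the other from the upper bound on its
    norm.\<close>
  define P where "P = sqrt (L * exp (\<alpha> * h\<^sup>2)) * C"
  have P: "0 < P" using L_pos C by (simp add: P_def)
  \<comment> \<open>\<open>1 / 2\<close> gives \<open>\<delta> < 1\<close>, \<open>h / 2\<close>
    admits the Lipschitz bound, and the last entry keeps the oscillation below half of the lower
    bound for \<open>|g a|\<close>.\<close>
  define \<delta> where "\<delta> = min (1 / 2) (min (h / 2) (h / (4 * P * G)))"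
  have \<delta>: "0 < \<delta>" "\<delta> < 1" "\<delta> \<le> h / 2" "\<delta> \<le> h / (4 * P * G)"
    using h_pos P G by (auto simp: \<delta>_def)
  \<comment> \<open>\<open>1 / (2 * G)\<close> is the lower bound for \<open>|g z| * V a\<close>;
    the exponential pays for undoing the twist at distance at most 1.\<close>
  define c where "c = exp (- (\<alpha> / 2)) / (2 * G)"
  have c: "0 < c" using G by (simp add: c_def)
  have "c * exp (\<alpha> / 2 * (cmod a)\<^sup>2 + \<alpha> / 2 * (cmod z)\<^sup>2) \<le> cmod (B z) * V a"
    if B: "B \<in> H" and ext: "\<And>f. f \<in> H \<Longrightarrow> (cmod (f a))\<^sup>2 \<le> nrm2 B * nrm2 f"
      and Ba: "B a = of_real (nrm2 B)" and z: "z \<in> ball a \<delta>" for a z B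
  proof -
    define b where "b = nrm2 B"
    define e where "e = exp (\<alpha> * (cmod a)\<^sup>2)"
    have e0: "0 < e" by (simp add: e_def)
    have b0: "0 \<le> b" by (simp add: b_def nrm2_nonneg)
    have ne: "exp (- \<alpha> * (cmod a)\<^sup>2) = 1 / e"
      by (simp add: e_def exp_minus field_simps)
    have Va: "0 < V a" by (rule V_pos)
    \<comment> \<open>Extremality is tested on the exponential, whose squared modulus at
      \<open>a\<close> is \<open>e * e\<close>.\<close>
    have "e * e = (cmod (exp (of_real \<alpha> * (cnj a * a))))\<^sup>2"
      unfolding cmod_exp_twist_square by (simp add: e_def)
    also have "\<dots> \<le> b * nrm2 (\<lambda>z. exp (of_real \<alpha> * (cnj a * z)))"
      unfolding b_def by (rule ext[OF test_H])
    also have "\<dots> \<le> b * (e * (G * V a))"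
      unfolding e_def by (rule mult_left_mono[OF test_le b0])
    finally have "e * e \<le> e * (b * (G * V a))" by (simp add: mult_ac)
    then have b_lower: "e \<le> b * (G * V a)" using e0 by simp
    have bp: "0 < b"
    proof (rule ccontr)
      assume "\<not> 0 < b"
      then have "b = 0" using b0 by simp
      then show False using b_lower e0 by simp
    qed
    \<comment> \<open>Evaluating \<open>B\<close> at its own centre, where \<open>|B a| = b\<close>,
      makes the estimate quadratic against linear in \<open>b\<close>.\<close>
    have "b\<^sup>2 * (1 / e) * V a \<le> C * b"
      using ev[OF B, of a] unfolding ne by (simp add: Ba b_def)
    then have "b * (b * V a) \<le> b * (C * e)"
      using e0 by (simp add: field_simps power2_eq_square)
    then have b_upper: "b * V a \<le> C * e" using bp by simp
    \<comment> \<open>Unlike \<open>|B|\<close> times the Gaussian, this normalisation stays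
      holomorphic, so Cauchy's estimate is available.\<close>
    define g where "g \<zeta> = B \<zeta> * exp (of_real (- \<alpha>) * (cnj a * \<zeta>))" for \<zeta>
    have B_hol: "B holomorphic_on UNIV" using B by (simp add: H_def)
    then have g_hol: "g holomorphic_on UNIV"
      unfolding g_def by (intro holomorphic_intros)
    have gsq: "(cmod (g \<zeta>))\<^sup>2 = (cmod (B \<zeta>))\<^sup>2 * exp (- \<alpha> * (cmod \<zeta>)\<^sup>2) * (exp (\<alpha> * (cmod (\<zeta> - a))\<^sup>2) / e)" for \<zeta>
      unfolding g_def norm_mult power_mult_distrib cmod_exp_twist_square
      by (simp add: e_def exp_minus field_simps)
    have g_upper: "cmod (g \<zeta>) \<le> P / V a" if \<zeta>: "\<zeta> \<in> cball a h" for \<zeta>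
    proof (rule power2_le_imp_le)
      have d: "cmod (\<zeta> - a) \<le> h" using \<zeta> by (simp add: dist_norm norm_minus_commute)
      have "(cmod (\<zeta> - a))\<^sup>2 \<le> h\<^sup>2" using d by (intro power_mono) auto
      then have ex: "exp (\<alpha> * (cmod (\<zeta> - a))\<^sup>2) / e \<le> exp (\<alpha> * h\<^sup>2) / e"
        using \<alpha> e0 by (intro divide_right_mono) auto
      have VL: "V a \<le> L * V \<zeta>"
        using V_compare[of a \<zeta> 1] \<zeta> by simp
      have "(cmod (B \<zeta>))\<^sup>2 * exp (- \<alpha> * (cmod \<zeta>)\<^sup>2) * V a
          \<le> (cmod (B \<zeta>))\<^sup>2 * exp (- \<alpha> * (cmod \<zeta>)\<^sup>2) * (L * V \<zeta>)"
        by (rule mult_left_mono[OF VL]) simp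
      also have "\<dots> = L * ((cmod (B \<zeta>))\<^sup>2 * exp (- \<alpha> * (cmod \<zeta>)\<^sup>2) * V \<zeta>)" by simp
      also have "\<dots> \<le> L * (C * b)"
        unfolding b_def using L_pos by (intro mult_left_mono ev[OF B]) auto
      finally have "(cmod (B \<zeta>))\<^sup>2 * exp (- \<alpha> * (cmod \<zeta>)\<^sup>2) * V a \<le> L * (C * b)" .
      then have "(cmod (B \<zeta>))\<^sup>2 * exp (- \<alpha> * (cmod \<zeta>)\<^sup>2) * V a * V a \<le> L * (C * b) * V a"
        using Va by (intro mult_right_mono) auto
      also have "\<dots> = L * C * (b * V a)" by simp
      also have "\<dots> \<le> L * C * (C * e)"
        using L_pos C by (intro mult_left_mono[OF b_upper]) auto
      finally have BV: "(cmod (B \<zeta>))\<^sup>2 * exp (- \<alpha> * (cmod \<zeta>)\<^sup>2) * V a * V a \<le> L * C * (C * e)" .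
      have "(cmod (g \<zeta>))\<^sup>2 * (V a)\<^sup>2
          = ((cmod (B \<zeta>))\<^sup>2 * exp (- \<alpha> * (cmod \<zeta>)\<^sup>2) * V a * V a) * (exp (\<alpha> * (cmod (\<zeta> - a))\<^sup>2) / e)"
        unfolding gsq by (simp add: power2_eq_square)
      also have "\<dots> \<le> (L * C * (C * e)) * (exp (\<alpha> * h\<^sup>2) / e)"
        by (rule mult_mono[OF BV ex]) (use L_pos C e0 in auto)
      also have "\<dots> = P\<^sup>2"
        using e0 L_pos by (simp add: P_def power_mult_distrib power2_eq_square[of C])
      finally show "(cmod (g \<zeta>))\<^sup>2 \<le> (P / V a)\<^sup>2"
        using Va by (simp add: power_divide field_simps)
    qed (use P Va in simp)
    have "cmod (z - a) < \<delta>" using z by (simp add: dist_norm norm_minus_commute)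
    then have za: "cmod (z - a) \<le> h / 2" "cmod (z - a) \<le> h / (4 * P * G)" "cmod (z - a) \<le> 1"
      using \<delta> by linarith+
    have "cmod (g z - g a) \<le> 2 * (P / V a) / h * cmod (z - a)"
      using g_hol holomorphic_on_imp_continuous_on[OF g_hol] h_pos g_upper za(1)
      by (intro holomorphic_bounded_lipschitz) (auto elim: holomorphic_on_subset continuous_on_subset)
    also have "\<dots> \<le> 2 * (P / V a) / h * (h / (4 * P * G))"
      using za(2) P Va h_pos by (intro mult_left_mono) auto
    also have "\<dots> = 1 / (2 * G * V a)"
      using P h_pos Va G by (simp add: field_simps)
    finally have osc: "cmod (g z - g a) \<le> 1 / (2 * G * V a)" .
    have "cmod (g a) = b / e"
    proof (rule power2_eq_imp_eq)
      show "(cmod (g a))\<^sup>2 = (b / e)\<^sup>2"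
        unfolding gsq ne by (simp add: Ba b_def power2_eq_square)
    qed (use bp e0 in auto)
    moreover have "1 / (G * V a) \<le> b / e"
      using b_lower e0 G Va by (simp add: field_simps)
    ultimately have "1 / (G * V a) \<le> cmod (g a)" by simp
    moreover have "1 / (G * V a) = 1 / (2 * G * V a) + 1 / (2 * G * V a)"
      using G Va by (simp add: field_simps)
    ultimately have g_lower: "1 / (2 * G * V a) \<le> cmod (g z)"
      using osc norm_triangle_ineq2[of "g a" "g z"] norm_minus_commute[of "g a" "g z"] by linarith
    define E where "E = exp (\<alpha> / 2 * (cmod a)\<^sup>2 + \<alpha> / 2 * (cmod z)\<^sup>2)"
    have E: "0 < E" "E\<^sup>2 = e * exp (\<alpha> * (cmod z)\<^sup>2)"
      by (simp_all add: E_def e_def flip: exp_double exp_add)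
    \<comment> \<open>Undoing the twist: \<open>(|g z| * E)^2\<close> is \<open>|B z|^2\<close>
      times \<open>exp (\<alpha> * |z - a|^2)\<close>, and that factor is at most
      \<open>exp \<alpha>\<close>.\<close>
    have "(cmod (g z) * (E * exp (- (\<alpha> / 2))))\<^sup>2 \<le> (cmod (B z))\<^sup>2"
    proof -
      have "(cmod (z - a))\<^sup>2 \<le> 1" using za(3) by (simp add: power_le_one)
      then have "exp (\<alpha> * (cmod (z - a))\<^sup>2) \<le> exp \<alpha>" using \<alpha> by simp
      moreover have "exp (- (\<alpha> / 2)) ^ 2 * exp \<alpha> = 1"
        by (simp flip: exp_double exp_add)
      ultimately have small: "exp (\<alpha> * (cmod (z - a))\<^sup>2) * exp (- (\<alpha> / 2)) ^ 2 \<le> 1"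
        by (metis mult.commute mult_left_mono zero_le_power2)
      have "exp (- \<alpha> * (cmod z)\<^sup>2) * exp (\<alpha> * (cmod z)\<^sup>2) = 1"
        by (simp flip: exp_add)
      then have "(cmod (g z) * (E * exp (- (\<alpha> / 2))))\<^sup>2
          = (cmod (B z))\<^sup>2 * (exp (\<alpha> * (cmod (z - a))\<^sup>2) * exp (- (\<alpha> / 2)) ^ 2)"
        unfolding power_mult_distrib gsq E(2) using e0 by (simp add: field_simps)
      also have "\<dots> \<le> (cmod (B z))\<^sup>2 * 1"
        by (rule mult_left_mono[OF small]) simp
      finally show ?thesis by simp
    qed
    then have Bz: "cmod (g z) * (E * exp (- (\<alpha> / 2))) \<le> cmod (B z)"
      by (rule power2_le_imp_le) simp
    have "c * E = 1 / (2 * G * V a) * (E * exp (- (\<alpha> / 2))) * V a"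
      using Va by (simp add: c_def)
    also have "\<dots> \<le> cmod (g z) * (E * exp (- (\<alpha> / 2))) * V a"
      using g_lower E(1) Va by (intro mult_right_mono) auto
    also have "\<dots> \<le> cmod (B z) * V a"
      using Bz Va by (intro mult_right_mono) auto
    finally show ?thesis by (simp add: E_def)
  qed
  with \<delta>(1,2) c show thesis by (rule that)
qed

end

section \<open>Transfer to the weighted Fock space\<close>

theorem theorem3p2:
  fixes \<alpha> :: real and w :: "complex \<Rightarrow> real"
  assumes "\<alpha> > 0" and "w \<in> A_infty_restricted"
  shows "\<exists>\<delta>::real. 0 < \<delta> \<and> \<delta> < 1 \<and>
    (\<forall>r>0. \<exists>C>0. \<forall>a. \<forall>z\<in>ball a \<delta>.
       cmod (fock_kernel \<alpha> w a z) \<ge>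
         C * (exp (\<alpha> / 2 * (cmod a)\<^sup>2 + \<alpha> / 2 * (cmod z)\<^sup>2) / weight_mass w (ball a r)))"
proof -
  have w: "weight w"
    using assms(2) by (auto simp: A_infty_restricted_def A_restricted_def)
  obtain r0 K :: real and N :: nat where r0: "0 < r0" and K: "0 < K" and N: "0 < N" and dbl:
    "\<And>b c s. 0 < s \<Longrightarrow> square c s \<subseteq> square b r0 \<Longrightarrow>
       0 < weight_mass w (square c s) \<and>
       weight_mass w (square b r0) \<le> K * (r0 / s) ^ N * weight_mass w (square c s)"
    using that by (rule A_infty_subsquare_doubling[OF assms(2)])
  \<comment> \<open>With \<open>h = r0 / 4\<close> the ambient squares of side \<open>4 * h\<close>
    are those of the \<open>A_p\<close> condition.\<close>
  interpret subsquare_doubling "weight_measure w" "r0 / 4" K N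
    by standard (use r0 K N dbl emeasure_weight_measure_compact[OF w compact_square]
        in \<open>simp_all add: weight_mass_eq_measure[OF w]\<close>)
  interpret entire_L2 "gauss \<alpha>" by (rule entire_L2_gauss[OF assms(1)])
  have mw: "w \<in> borel_measurable lebesgue" by (rule weight_measurable[OF w])
  have mexp: "(\<lambda>z. exp (- \<alpha> * (cmod z)\<^sup>2)) \<in> borel_measurable lebesgue"
    using gauss_weight_measurable by (simp add: measurable_cong_sets[OF sets_weight_measure refl])
  have gauss_eq: "gauss \<alpha> = density lebesgue (\<lambda>z. ennreal (exp (- \<alpha> * (cmod z)\<^sup>2) * w z))"
    unfolding gauss_def unfolding weight_measure_def using mw mexp
    by (subst density_density_eq) (auto simp: ennreal_mult weight_nonneg[OF w] mult.commute)
  have dens: "(\<lambda>z. exp (- \<alpha> * (cmod z)\<^sup>2) * w z) \<in> borel_measurable lebesgue"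
    "AE z in lebesgue. 0 \<le> exp (- \<alpha> * (cmod z)\<^sup>2) * w z"
    using mw mexp by (auto simp: weight_nonneg[OF w])
  have leb: "f \<in> borel_measurable lebesgue" if "f holomorphic_on UNIV" for f :: "complex \<Rightarrow> complex"
    using holomorphic_measurable[OF that] by (simp add: measurable_cong_sets[OF sets_\<nu> refl])
  have H_eq: "fock_space \<alpha> w = H"
  proof -
    have "integrable (gauss \<alpha>) (\<lambda>z. (cmod (f z))\<^sup>2)
        \<longleftrightarrow> integrable lebesgue (\<lambda>z. (cmod (f z))\<^sup>2 * exp (- \<alpha> * (cmod z)\<^sup>2) * w z)"
      if "f holomorphic_on UNIV" for f
    proof -
      have "(\<lambda>z. (cmod (f z))\<^sup>2) \<in> borel_measurable lebesgue"
        using leb[OF that] by measurable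
      from integrable_density[OF this dens]
      show ?thesis unfolding gauss_eq by (simp add: mult_ac)
    qed
    then show ?thesis unfolding fock_space_def H_def by blast
  qed
  have ip_eq: "fock_inner \<alpha> w f g = ip f g" if "f \<in> H" "g \<in> H" for f g
  proof -
    have "(\<lambda>z. f z * cnj (g z)) \<in> borel_measurable (gauss \<alpha>)"
      using integrable_ip[OF that] by (rule borel_measurable_integrable)
    then have "(\<lambda>z. f z * cnj (g z)) \<in> borel_measurable lebesgue"
      by (simp add: measurable_cong_sets[OF sets_\<nu> refl])
    from integral_density[OF this dens]
    have "ip f g = (LINT z|lebesgue. of_real (exp (- \<alpha> * (cmod z)\<^sup>2) * w z) * (f z * cnj (g z)))"
      unfolding ip_def unfolding gauss_eq scaleR_conv_of_real .
    also have "\<dots> = fock_inner \<alpha> w f g"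
      unfolding fock_inner_def by (intro Bochner_Integration.integral_cong refl mult.commute)
    finally show ?thesis by simp
  qed
  \<comment> \<open>\<open>\<delta>\<close> is fixed before \<open>r\<close> appears; the choice of
    \<open>r\<close> will change only the constant.\<close>
  obtain \<delta> c where \<delta>: "0 < \<delta>" "\<delta> < 1" and c: "0 < c" and lower: "\<And>a z B. B \<in> H \<Longrightarrow>
       (\<And>f. f \<in> H \<Longrightarrow> (cmod (f a))\<^sup>2 \<le> nrm2 B * nrm2 f) \<Longrightarrow>
       B a = of_real (nrm2 B) \<Longrightarrow> z \<in> ball a \<delta> \<Longrightarrow>
       c * exp (\<alpha> / 2 * (cmod a)\<^sup>2 + \<alpha> / 2 * (cmod z)\<^sup>2) \<le> cmod (B z) * V a"
    using kernel_lower_bound[OF assms(1)] by metis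
  have kernel: "c * exp (\<alpha> / 2 * (cmod a)\<^sup>2 + \<alpha> / 2 * (cmod z)\<^sup>2) \<le> cmod (fock_kernel \<alpha> w a z) * V a"
    if z: "z \<in> ball a \<delta>" for a z
  proof -
    \<comment> \<open>The exponential has no zeros, so it witnesses that evaluation at
      \<open>a\<close> is nontrivial on \<open>H\<close>.\<close>
    have "(\<lambda>z. exp (of_real \<alpha> * (cnj a * z))) \<in> H"
      unfolding H_def using test_function[OF assms(1)]
      by (intro CollectI conjI holomorphic_intros) metis
    then obtain B where B: "B \<in> H" and rep: "\<And>f. f \<in> H \<Longrightarrow> f a = ip f B"
      and ext: "\<And>f. f \<in> H \<Longrightarrow> (cmod (f a))\<^sup>2 \<le> nrm2 B * nrm2 f"
      using reproducing_kernel_exists[of _ a] by (metis exp_not_eq_zero)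
    have "fock_kernel \<alpha> w a = B"
      unfolding fock_kernel_def is_fock_kernel_def H_eq
    proof (rule the_equality)
      show "B \<in> H \<and> (\<forall>f\<in>H. f a = fock_inner \<alpha> w f B)"
        using B rep ip_eq by simp
      show "B' = B" if "B' \<in> H \<and> (\<forall>f\<in>H. f a = fock_inner \<alpha> w f B')" for B'
        using that ip_eq B rep by (intro reproducing_kernel_unique[of B' a B]) auto
    qed
    moreover have "B a = of_real (nrm2 B)"
      using rep[OF B] ip_self by simp
    ultimately show ?thesis using lower[OF B ext _ z] by simp
  qed
  have "\<exists>C>0. \<forall>a. \<forall>z\<in>ball a \<delta>. cmod (fock_kernel \<alpha> w a z) \<ge>
         C * (exp (\<alpha> / 2 * (cmod a)\<^sup>2 + \<alpha> / 2 * (cmod z)\<^sup>2) / weight_mass w (ball a r))"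
    if r: "0 < r" for r
  proof -
    obtain D where D: "0 < D" and VD: "\<And>a. V a \<le> D * measure (weight_measure w) (ball a r)"
      using that by (rule V_le_ball[OF r])
    have "c / D * (exp (\<alpha> / 2 * (cmod a)\<^sup>2 + \<alpha> / 2 * (cmod z)\<^sup>2) / weight_mass w (ball a r))
        \<le> cmod (fock_kernel \<alpha> w a z)" if z: "z \<in> ball a \<delta>" for a z
    proof -
      define m where "m = weight_mass w (ball a r)"
      have Vm: "V a \<le> D * m"
        using VD[of a] by (simp add: m_def weight_mass_eq_measure[OF w])
      \<comment> \<open>The disk has positive mass because \<open>V a > 0\<close>, so the quotient
        in the claim is genuine and can be cleared.\<close>
      then have "0 < D * m" using V_pos[of a] by linarith
      then have m: "0 < m" using D by (simp add: zero_less_mult_iff)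
      have "c * exp (\<alpha> / 2 * (cmod a)\<^sup>2 + \<alpha> / 2 * (cmod z)\<^sup>2) \<le> cmod (fock_kernel \<alpha> w a z) * (D * m)"
        using kernel[OF z] mult_left_mono[OF Vm norm_ge_zero] by (rule order_trans)
      then show ?thesis
        using D m unfolding m_def[symmetric] by (simp add: field_simps)
    qed
    moreover have "0 < c / D" using c D by simp
    ultimately show ?thesis by blast
  qed
  with \<delta> show ?thesis by blast
qed

end
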